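(* Let $n\ge1$, $s\in(0,1)$, let $\Omega\subset\mathbb R^n$ be a bounded open set with Lipschitz boundary, and let $f\in L^{\frac ns}(\Omega)$. Let $u\in\mathcal W_0^{s,1}(\Omega)$ be a weak solution of $(-\Delta)_1^su=f$ in $\Omega$, $u=0$ in $\mathbb R^n\setminus\Omega$. Then the set $$\{(x,y)\in Q(\Omega)\ :\ u(x)=u(y)\}$$ has positive ($2n$-dimensional) Lebesgue measure. In other words, there exists no function $u\in\mathcal W_0^{s,1}(\Omega)$ such that $u(x)\ne u(y)$ for almost every $(x,y)\in Q(\Omega)$, $x\neq y$, and such that $u$ is a weak solution of this problem.
   Context: $Q(\Omega):=\mathbb R^{2n}\setminus(\mathbb R^n\setminus\Omega)^2$. $\mathcal W^{s,1}_0(\Omega)$ is the closure of $C_c^\infty(\Omega)$ in the norm $\|u\|_{W^{s,1}(\Omega)}=\|u\|_{L^1(\Omega)}+\int_\Omega\int_\Omega\frac{|u(x)-u(y)|}{|x-y|^{n+s}}dxdy$, its elements being functions on $\mathbb R^n$ vanishing on $\mathbb R^n\setminus\Omega$ (for Lipschitz bounded $\Omega$ it equals the set of all $u:\mathbb R^n\to\mathbb R$ with $u=0$ on $\mathbb R^n\setminus\Omega$ and finite norm). Weak solution: $u$ is a weak solution of $(-\Delta)_1^su=f$ in $\Omega$, $u=0$ in $\mathbb R^n\setminus\Omega$, if $u\in\mathcal W_0^{s,1}(\Omega)$ and there exists $\mathbf z\in L^\infty(\mathbb R^{2n})$ with $\|\mathbf z\|_{L^\infty(\mathbb R^{2n})}\le1$,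 $\mathbf z(x,y)=-\mathbf z(y,x)$, such that $\frac12\iint_{\mathbb R^{2n}}\frac{\mathbf z(x,y)}{|x-y|^{n+s}}(w(x)-w(y))dxdy=\int_\Omega fw\,dx$ for all $w\in\mathcal W_0^{s,1}(\Omega)$, and $\mathbf z(x,y)\in\operatorname{sgn}(u(x)-u(y))$ for a.e. $(x,y)\in Q(\Omega)$. Here $\operatorname{sgn}(t)=\{1\}$ if $t>0$, $\{-1\}$ if $t<0$, $[-1,1]$ if $t=0$. *)

theory Defs
  imports "HOL-Analysis.Analysis"
begin

text \<open>
  The space \<open>\<real>\<^sup>n\<close> is an arbitrary type of class \<open>euclidean_space\<close> with \<open>n = DIM('a) \<ge> 1\<close>, and
  \<open>\<real>\<^sup>2\<^sup>n\<close> is the Euclidean space \<open>'a \<times> 'a\<close>. Elements of Lebesgue and Sobolev spaces are represented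
  by functions on the whole space; conditions on them are imposed almost everywhere, so that they
  depend only on the class modulo null sets.
\<close>

text \<open>Near each boundary point the set is, in a suitable direction \<open>e\<close>, the part of a ball lying
  strictly above the graph of a Lipschitz function \<open>g\<close> on the hyperplane orthogonal to \<open>e\<close>.\<close>

definition lipschitz_boundary :: "'a::euclidean_space set \<Rightarrow> bool" where
  "lipschitz_boundary \<Omega> \<longleftrightarrow>
    (\<forall>p\<in>frontier \<Omega>. \<exists>r>0. \<exists>e. norm e = 1 \<and>
      (\<exists>L g. L-lipschitz_on {y. y \<bullet> e = 0} g \<and>
        \<Omega> \<inter> ball p r = {x \<in> ball p r. g (x - (x \<bullet> e) *\<^sub>R e) < x \<bullet> e}))"

primrec C_k :: "nat \<Rightarrow> ('a::euclidean_space \<Rightarrow> real) \<Rightarrow> bool" where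
  "C_k 0 f \<longleftrightarrow> continuous_on UNIV f"
| "C_k (Suc k) f \<longleftrightarrow>
    (\<forall>x. f differentiable at x) \<and> (\<forall>v. C_k k (\<lambda>x. frechet_derivative f (at x) v))"

definition test_functions :: "'a::euclidean_space set \<Rightarrow> ('a \<Rightarrow> real) set" where
  "test_functions \<Omega> =
    {\<phi>. (\<forall>k. C_k k \<phi>) \<and> compact (closure {x. \<phi> x \<noteq> 0}) \<and> closure {x. \<phi> x \<noteq> 0} \<subseteq> \<Omega>}"

definition Ws1_norm :: "real \<Rightarrow> 'a::euclidean_space set \<Rightarrow> ('a \<Rightarrow> real) \<Rightarrow> ennreal" where
  "Ws1_norm s \<Omega> u =
    (\<integral>\<^sup>+x\<in>\<Omega>. ennreal \<bar>u x\<bar> \<partial>lebesgue) +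
    (\<integral>\<^sup>+p\<in>\<Omega> \<times> \<Omega>. ennreal (\<bar>u (fst p) - u (snd p)\<bar> / norm (fst p - snd p) powr (real DIM('a) + s))
       \<partial>lebesgue)"

definition Ws1_0 :: "real \<Rightarrow> 'a::euclidean_space set \<Rightarrow> ('a \<Rightarrow> real) set" where
  "Ws1_0 s \<Omega> =
    {u. u \<in> borel_measurable lebesgue \<and> (AE x in lebesgue. x \<notin> \<Omega> \<longrightarrow> u x = 0) \<and>
        (\<forall>\<epsilon>>0. \<exists>\<phi>\<in>test_functions \<Omega>. Ws1_norm s \<Omega> (\<lambda>x. u x - \<phi> x) < \<epsilon>)}"

definition Q :: "'a set \<Rightarrow> ('a \<times> 'a) set" where
  "Q \<Omega> = UNIV - (UNIV - \<Omega>) \<times> (UNIV - \<Omega>)"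

definition Sgn :: "real \<Rightarrow> real set" where
  "Sgn t = (if t > 0 then {1} else if t < 0 then {-1} else {-1..1})"

definition L_space :: "real \<Rightarrow> 'a::euclidean_space set \<Rightarrow> ('a \<Rightarrow> real) set" where
  "L_space p \<Omega> =
    {f. set_borel_measurable lebesgue \<Omega> f \<and> set_integrable lebesgue \<Omega> (\<lambda>x. \<bar>f x\<bar> powr p)}"

definition weak_solution ::
    "real \<Rightarrow> 'a::euclidean_space set \<Rightarrow> ('a \<Rightarrow> real) \<Rightarrow> ('a \<Rightarrow> real) \<Rightarrow> bool" where
  "weak_solution s \<Omega> f u \<longleftrightarrow>
    u \<in> Ws1_0 s \<Omega> \<and>
    (\<exists>z :: 'a \<times> 'a \<Rightarrow> real.
      z \<in> borel_measurable lebesgue \<and>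
      (AE p in lebesgue. \<bar>z p\<bar> \<le> 1) \<and>
      (AE p in lebesgue. z p = - z (snd p, fst p)) \<and>
      (\<forall>w\<in>Ws1_0 s \<Omega>.
        1 / 2 * (LINT p|lebesgue. z p / norm (fst p - snd p) powr (real DIM('a) + s) *
                   (w (fst p) - w (snd p)))
        = (LINT x:\<Omega>|lebesgue. f x * w x)) \<and>
      (AE p in lebesgue. p \<in> Q \<Omega> \<longrightarrow> z p \<in> Sgn (u (fst p) - u (snd p))))"

end

theory Submission
  imports Defs
begin

text \<open>Why the theorem holds. For a level \<open>t > 0\<close> let \<open>E\<^sub>t = {x \<in> \<Omega>. t < u x}\<close>, and let \<open>z\<close> be the sign
  field of the weak solution \<open>u\<close>. Since \<open>z\<close> agrees with the sign of \<open>u x - u y\<close>, it calibrates every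
  superlevel set: formally, testing the equation with the indicator of \<open>E\<^sub>t\<close> gives that the fractional
  perimeter of \<open>E\<^sub>t\<close> equals the integral of \<open>f\<close> over \<open>E\<^sub>t\<close>. The fractional perimeter is at least a
  constant times \<open>\<bar>E\<^sub>t\<bar>\<close> to the power \<open>1 - s/n\<close>, and the integral of \<open>f\<close> is at most the \<open>L\<close>-norm of \<open>f\<close>
  over \<open>E\<^sub>t\<close> with exponent \<open>n/s\<close> times the same power. Hence, if \<open>u\<close> attains the level \<open>t\<close> on a null
  set only and \<open>E\<^sub>t\<close> has positive measure, then \<open>E\<^sub>t\<close> carries at least a fixed
  amount \<open>\<delta>\<close>, depending on \<open>n\<close> and \<open>s\<close> only, of the integral of \<open>\<bar>f\<bar>\<close> to the power \<open>n/s\<close> (\<open>superlevel_set_mass\<close>).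

  If all level sets of \<open>u\<close> in \<open>\<Omega>\<close> were null, then (replacing \<open>u\<close> by \<open>-u\<close> if \<open>u \<le> 0\<close> almost everywhere)
  the integral of \<open>1 + \<bar>f\<bar>\<close> to the power \<open>n/s\<close> over \<open>E\<^sub>t\<close> would depend continuously on \<open>t\<close>, be
  positive at \<open>t = 0\<close> and tend to \<open>0\<close> as \<open>t\<close> grows. So some \<open>E\<^sub>t\<close> would have positive measure and
  carry less than \<open>\<delta>\<close>, which is impossible. Therefore some level set \<open>A = {x \<in> \<Omega>. u x = c}\<close> has
  positive measure, and \<open>A \<times> A\<close> is a subset of \<open>Q \<Omega>\<close> of positive measure on which \<open>u x = u y\<close>.

  The point that needs care is to test the equation with a function of \<open>u\<close>. Let \<open>H\<close> be smooth, bounded,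
  nondecreasing and Lipschitz with \<open>H 0 = 0\<close>, and let the test functions \<open>\<phi>\<^sub>j\<close> converge to \<open>u\<close>. The
  equation is tested with \<open>H (u x) * (H (\<phi>\<^sub>j x))\<^sup>2\<close>. This function has compact support in \<open>\<Omega>\<close>, so that
  its pairing with \<open>z\<close> converges absolutely, and it has the sign of \<open>u\<close>, so that the interaction between
  \<open>\<Omega>\<close> and its complement contributes a nonnegative amount and Fatou's lemma applies. In the limit,
  the energy on the whole space of \<open>H (u x) ^ 3\<close>, extended by \<open>0\<close>, is at most twice its integral against \<open>f\<close>
  (\<open>energy_profile_le\<close>). Letting \<open>H\<close> tend to the indicator of \<open>{t<..}\<close> gives the inequality for
  \<open>E\<^sub>t\<close> (\<open>superlevel_set_energy_le\<close>).\<close>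

section \<open>Smooth functions and test functions\<close>

lemma C_k_SucD: "C_k (Suc k) f \<Longrightarrow> C_k k f"
proof (induction k arbitrary: f)
  case 0
  then show ?case
    by (auto simp: continuous_on_eq_continuous_at intro: differentiable_imp_continuous_within)
next
  case (Suc k)
  then show ?case using C_k.simps(2) by blast
qed

lemma C_k_const: "C_k k (\<lambda>x. c)"
  by (induction k arbitrary: c) auto

lemma C_k_add: "C_k k f \<Longrightarrow> C_k k g \<Longrightarrow> C_k k (\<lambda>x. f x + g x)"
proof (induction k arbitrary: f g)
  case 0 then show ?case by (auto intro: continuous_intros)
next
  case (Suc k)
  have "frechet_derivative (\<lambda>x. f x + g x) (at x) v
      = frechet_derivative f (at x) v + frechet_derivative g (at x) v" for x v
  proof -
    have "((\<lambda>x. f x + g x) has_derivative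
        (\<lambda>v. frechet_derivative f (at x) v + frechet_derivative g (at x) v)) (at x)"
      using Suc.prems by (auto intro!: derivative_intros simp: frechet_derivative_works[symmetric])
    from frechet_derivative_at[OF this] show ?thesis by metis
  qed
  then show ?case using Suc by auto
qed

lemma C_k_mult: "C_k k f \<Longrightarrow> C_k k g \<Longrightarrow> C_k k (\<lambda>x. f x * g x)"
proof (induction k arbitrary: f g)
  case 0 then show ?case by (auto intro: continuous_intros)
next
  case (Suc k)
  have "frechet_derivative (\<lambda>x. f x * g x) (at x) v
      = f x * frechet_derivative g (at x) v + frechet_derivative f (at x) v * g x" for x v
  proof -
    have "((\<lambda>x. f x * g x) has_derivative
        (\<lambda>v. f x * frechet_derivative g (at x) v + frechet_derivative f (at x) v * g x)) (at x)"
      using Suc.prems by (auto intro!: derivative_intros simp: frechet_derivative_works[symmetric])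
    from frechet_derivative_at[OF this] show ?thesis by metis
  qed
  moreover have "C_k k f" "C_k k g" using Suc.prems C_k_SucD by blast+
  ultimately show ?case using Suc by (auto intro!: C_k_add)
qed

text \<open>The derivative of \<open>tanh\<close> is the polynomial \<open>1 - tanh\<^sup>2\<close> in \<open>tanh\<close> itself, so the induction on the
  order of differentiability closes without any description of the higher derivatives.\<close>

lemma C_k_tanh: "C_k k f \<Longrightarrow> C_k k (\<lambda>x. tanh (f x))"
proof (induction k arbitrary: f)
  case 0 then show ?case by (auto intro!: continuous_intros simp: cosh_real_nonzero)
next
  case (Suc k)
  have *: "((\<lambda>x. tanh (f x)) has_derivative
        (\<lambda>v. (1 + (-1) * (tanh (f x) * tanh (f x))) * frechet_derivative f (at x) v)) (at x)" for x
  proof -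
    have "(f has_derivative frechet_derivative f (at x)) (at x)"
      using Suc.prems by (auto simp: frechet_derivative_works[symmetric])
    moreover have "(tanh has_derivative (*) (1 - tanh (f x) ^ 2)) (at (f x))"
      using has_field_derivative_tanh[of "\<lambda>x. x" "f x", OF _ DERIV_ident]
      by (simp add: has_field_derivative_def)
    ultimately show ?thesis using diff_chain_at[of f _ x tanh]
      by (auto simp: o_def power2_eq_square)
  qed
  have **: "frechet_derivative (\<lambda>x. tanh (f x)) (at x)
      = (\<lambda>v. (1 + (-1) * (tanh (f x) * tanh (f x))) * frechet_derivative f (at x) v)" for x
    using frechet_derivative_at[OF *] by metis
  have "C_k k f" using Suc.prems C_k_SucD by blast
  then have tanh: "C_k k (\<lambda>x. tanh (f x))" by (rule Suc.IH)
  have "C_k k (\<lambda>x. frechet_derivative (\<lambda>x. tanh (f x)) (at x) v)" for v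
    unfolding ** using Suc.prems by (intro C_k_mult C_k_add C_k_const tanh) auto
  moreover have "(\<lambda>x. tanh (f x)) differentiable (at x)" for x
    using * differentiable_def by blast
  ultimately show ?case by simp
qed

lemma test_function_Lipschitz:
  fixes \<phi> :: "'a::euclidean_space \<Rightarrow> real"
  assumes "\<phi> \<in> test_functions \<Omega>"
  shows "\<exists>L\<ge>0. \<forall>x y. \<bar>\<phi> x - \<phi> y\<bar> \<le> L * norm (x - y)"
proof -
  let ?S = "closure {x. \<phi> x \<noteq> 0}"
  let ?D = "\<lambda>x. frechet_derivative \<phi> (at x)"
  have "C_k (Suc 0) \<phi>" "compact ?S" using assms unfolding test_functions_def by blast+
  then have diff: "\<phi> differentiable at x" and cont: "continuous_on UNIV (\<lambda>x. ?D x v)" for x v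
    by auto
  have der: "(\<phi> has_derivative ?D x) (at x)" for x
    using diff frechet_derivative_works by blast
  have out: "?D x v = 0" if "x \<notin> ?S" for x v
  proof -
    have "open (- ?S)" by auto
    have "(\<phi> has_derivative (\<lambda>_. 0)) (at x)"
      by (rule has_derivative_transform_within_open[where s="- ?S" and f="\<lambda>_. 0"])
         (use that closure_subset[of "{x. \<phi> x \<noteq> 0}"] in auto)
    then show ?thesis using frechet_derivative_at by metis
  qed
  have "\<exists>B. \<forall>x. \<bar>?D x b\<bar> \<le> B" for b
  proof -
    have "compact ((\<lambda>x. ?D x b) ` ?S)"
      using cont \<open>compact ?S\<close> by (metis compact_continuous_image continuous_on_subset subset_UNIV)
    then obtain B where "\<forall>x\<in>?S. \<bar>?D x b\<bar> \<le> B"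
      by (auto dest!: compact_imp_bounded simp: bounded_iff)
    then have "\<bar>?D x b\<bar> \<le> max B 0" for x using out[of x b] by (cases "x \<in> ?S") auto
    then show ?thesis by blast
  qed
  then obtain B where B: "\<And>b x. \<bar>?D x b\<bar> \<le> B b" by metis
  define L where "L = (\<Sum>b\<in>Basis. B b)"
  have "B b \<ge> 0" for b using B[of 0 b] by linarith
  then have "L \<ge> 0" unfolding L_def by (auto intro: sum_nonneg)
  have on: "onorm (?D x) \<le> L" for x
  proof (rule onorm_le)
    fix v
    have lin: "linear (?D x)" using der has_derivative_linear by blast
    have "?D x v = ?D x (\<Sum>b\<in>Basis. (v \<bullet> b) *\<^sub>R b)" by (simp add: euclidean_representation)
    also have "\<dots> = (\<Sum>b\<in>Basis. (v \<bullet> b) * ?D x b)"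
      using lin by (simp add: linear_sum linear_scale)
    also have "norm \<dots> \<le> (\<Sum>b\<in>Basis. norm v * B b)"
      by (rule sum_norm_le) (auto simp: abs_mult intro!: mult_mono B Basis_le_norm)
    finally show "norm (?D x v) \<le> L * norm v" unfolding L_def
      by (simp add: sum_distrib_left mult.commute)
  qed
  have "norm (\<phi> x - \<phi> y) \<le> L * norm (x - y)" for x y
    by (rule differentiable_bound[of UNIV \<phi> ?D]) (use der on in auto)
  then show ?thesis using \<open>L \<ge> 0\<close> by auto
qed

lemma test_function_bounded:
  assumes "\<phi> \<in> test_functions \<Omega>"
  shows "\<exists>B. \<forall>x. \<bar>\<phi> x\<bar> \<le> B"
proof -
  let ?S = "closure {x. \<phi> x \<noteq> 0}"
  have "C_k 0 \<phi>" "compact ?S" using assms unfolding test_functions_def by blast+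
  then have "compact (\<phi> ` ?S)"
    by (metis C_k.simps(1) compact_continuous_image continuous_on_subset subset_UNIV)
  then obtain B where "\<forall>x\<in>?S. \<bar>\<phi> x\<bar> \<le> B"
    by (auto dest!: compact_imp_bounded simp: bounded_iff)
  moreover have "\<phi> x = 0" if "x \<notin> ?S" for x
    using that closure_subset[of "{x. \<phi> x \<noteq> 0}"] by blast
  ultimately have "\<bar>\<phi> x\<bar> \<le> max B 0" for x
    by (metis abs_zero max.coboundedI1 max.cobounded2)
  then show ?thesis by blast
qed

lemma test_functionsI:
  assumes "\<phi> \<in> test_functions \<Omega>" "\<And>k. C_k k \<psi>" "\<And>x. \<phi> x = 0 \<Longrightarrow> \<psi> x = 0"
  shows "\<psi> \<in> test_functions \<Omega>"
proof -
  have sub: "closure {x. \<psi> x \<noteq> 0} \<subseteq> closure {x. \<phi> x \<noteq> 0}" using assms(3) by (intro closure_mono) auto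
  moreover have "compact (closure {x. \<psi> x \<noteq> 0})"
    using assms(1) sub unfolding test_functions_def
    by (metis (mono_tags, lifting) closed_closure compact_Int_closed inf.absorb_iff2 mem_Collect_eq)
  ultimately show ?thesis using assms(1,2) unfolding test_functions_def by blast
qed

lemma test_function_eq_0: "\<phi> \<in> test_functions \<Omega> \<Longrightarrow> x \<notin> \<Omega> \<Longrightarrow> \<phi> x = 0"
  using closure_subset[of "{x. \<phi> x \<noteq> 0}"] unfolding test_functions_def by blast

section \<open>The fractional energy of a test function is finite\<close>

text \<open>The layer-cake form in which singular kernels are estimated below: the function is dominated by a
  countable sum of multiples of indicators of balls.\<close>

lemma nn_integral_finite_by_balls:
  fixes g :: "'a::euclidean_space \<Rightarrow> real" and a R :: "nat \<Rightarrow> real"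
  assumes "\<And>h. g h > 0 \<Longrightarrow> \<exists>k. norm h \<le> R k \<and> g h \<le> a k"
    and [simp]: "\<And>k. 0 \<le> R k" "\<And>k. 0 \<le> a k"
    and "summable (\<lambda>k. a k * R k ^ DIM('a))"
  shows "(\<integral>\<^sup>+h. ennreal (g h) \<partial>lborel) < \<infinity>"
proof -
  let ?V = "unit_ball_vol (real DIM('a))"
  have le: "ennreal (g h) \<le> (\<Sum>k. ennreal (a k) * indicator (cball 0 (R k)) h)" for h
  proof (cases "g h > 0")
    case True
    then obtain k where k: "norm h \<le> R k" "g h \<le> a k" using assms(1) by blast
    define F where "F k = ennreal (a k) * indicator (cball 0 (R k)) h" for k
    have "ennreal (g h) \<le> F k"
      using k by (simp add: F_def ennreal_leI)
    also have "\<dots> \<le> suminf F"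
      using sum_le_suminf[of F "{k}"] by simp
    finally show ?thesis unfolding F_def .
  qed (simp add: ennreal_neg)
  have "(\<integral>\<^sup>+h. ennreal (g h) \<partial>lborel)
      \<le> (\<integral>\<^sup>+h. (\<Sum>k. ennreal (a k) * indicator (cball (0::'a) (R k)) h) \<partial>lborel)"
    by (intro nn_integral_mono le)
  also have "\<dots> = (\<Sum>k. \<integral>\<^sup>+h. ennreal (a k) * indicator (cball (0::'a) (R k)) h \<partial>lborel)"
    by (rule nn_integral_suminf) (simp add: borel_measurable_indicator borel_measurable_times_ennreal)
  also have "\<dots> = (\<Sum>k. ennreal (a k) * emeasure lborel (cball (0::'a) (R k)))"
    by (simp add: nn_integral_cmult_indicator)
  also have "\<dots> = (\<Sum>k. ennreal (?V * (a k * R k ^ DIM('a))))"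
    by (intro suminf_cong) (simp add: emeasure_cball ennreal_mult[symmetric] mult_ac)
  also have "\<dots> = ennreal (\<Sum>k. ?V * (a k * R k ^ DIM('a)))"
    by (rule suminf_ennreal2) (auto intro: summable_mult assms)
  finally show ?thesis by (simp add: le_less_trans)
qed

lemma power_powr: "0 < q \<Longrightarrow> (q ^ k) powr a = (q powr a) ^ k" for q a :: real
  by (induction k) (auto simp: powr_mult)

lemma dyadic_volume_term:
  "0 < q \<Longrightarrow> (q ^ k) powr (a - real n) * (q ^ k) ^ n = (q powr a) ^ k" for q a :: real
  using powr_realpow[of "q ^ k" n] by (simp add: powr_diff power_powr)

text \<open>On the annulus between the radii \<open>2 ^ k\<close> and \<open>2 ^ Suc k\<close> the kernel contributes at most a multiple
  of \<open>(2 powr (- s)) ^ k\<close>.\<close>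

lemma kernel_integrable_far:
  assumes "0 < s"
  shows "(\<integral>\<^sup>+h. ennreal (indicator {h::'a::euclidean_space. 1 \<le> norm h} h / norm h powr (real DIM('a) + s))
            \<partial>lborel) < \<infinity>"
proof (rule nn_integral_finite_by_balls[where R="\<lambda>k. 2 ^ Suc k" and
      a="\<lambda>k. (2 ^ k) powr (- s - real DIM('a))"])
  fix h :: 'a
  assume "indicator {h::'a. 1 \<le> norm h} h / norm h powr (real DIM('a) + s) > 0"
  then have h: "1 \<le> norm h" by (auto split: split_indicator_asm)
  define n where "n = (LEAST n. norm h < 2 ^ n)"
  have "\<exists>n. norm h < 2 ^ n" using real_arch_pow[of 2 "norm h"] by auto
  then have n: "norm h < 2 ^ n" unfolding n_def by (rule LeastI_ex)
  with h have "n \<noteq> 0" by (metis not_le power_0)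
  then obtain k where k: "n = Suc k" using not0_implies_Suc by blast
  have "2 ^ k \<le> norm h" using not_less_Least[of k "\<lambda>n. norm h < 2 ^ n"] k n_def by auto
  then have "norm h powr (- s - real DIM('a)) \<le> (2 ^ k) powr (- s - real DIM('a))"
    using assms by (intro powr_mono2') auto
  moreover have "norm h powr (- s - real DIM('a)) = 1 / norm h powr (real DIM('a) + s)"
    using powr_minus_divide[of "norm h" "real DIM('a) + s"] by (simp add: algebra_simps)
  ultimately show "\<exists>k. norm h \<le> 2 ^ Suc k \<and> indicator {h::'a. 1 \<le> norm h} h / norm h powr (real DIM('a) + s)
      \<le> (2 ^ k) powr (- s - real DIM('a))"
    using n h unfolding k by (intro exI[of _ k]) auto
next
  have "(2 ^ k) powr (- s - real DIM('a)) * (2 ^ Suc k) ^ DIM('a) = 2 ^ DIM('a) * (2 powr (- s)) ^ k" for k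
    unfolding power_Suc power_mult_distrib using dyadic_volume_term[of 2 k "- s" "DIM('a)"]
    by (metis mult.left_commute zero_less_numeral)
  moreover have "summable (\<lambda>k. 2 ^ DIM('a) * (2 powr (- s)) ^ k :: real)"
    using assms by (intro summable_mult summable_geometric) (simp add: powr_less_one)
  ultimately show "summable (\<lambda>k. (2 ^ k) powr (- s - real DIM('a)) * (2 ^ Suc k) ^ DIM('a))"
    by presburger
qed auto

text \<open>Lipschitz continuity of a test function gains one factor \<open>norm h\<close> near the diagonal; the annulus
  between the radii \<open>(1/2) ^ Suc k\<close> and \<open>(1/2) ^ k\<close> then contributes at most a multiple of
  \<open>((1/2) powr (1 - s)) ^ k\<close>.\<close>

lemma kernel_integrable_near:
  assumes "0 < s" "s < 1"
  shows "(\<integral>\<^sup>+h. ennreal (indicator {h::'a::euclidean_space. norm h < 1} h * norm h / norm h powr (real DIM('a) + s))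
            \<partial>lborel) < \<infinity>"
proof (rule nn_integral_finite_by_balls[where R="\<lambda>k. (1/2) ^ k" and
      a="\<lambda>k. ((1/2) ^ Suc k) powr (1 - s - real DIM('a))"])
  fix h :: 'a
  assume "indicator {h::'a. norm h < 1} h * norm h / norm h powr (real DIM('a) + s) > 0"
  then have h: "norm h < 1" "norm h > 0" by (auto split: split_indicator_asm)
  define n where "n = (LEAST n. (1/2) ^ n < norm h)"
  have "\<exists>n. (1/2) ^ n < norm h" using real_arch_pow_inv[of "norm h" "1/2"] h by auto
  then have n: "(1/2) ^ n < norm h" unfolding n_def by (rule LeastI_ex)
  with h have "n \<noteq> 0" by (metis not_less_iff_gr_or_eq power_0)
  then obtain k where k: "n = Suc k" using not0_implies_Suc by blast
  have le: "norm h \<le> (1/2) ^ k" using not_less_Least[of k "\<lambda>n. (1/2) ^ n < norm h"] k n_def by auto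
  have "1 - s - real DIM('a) \<le> 0" using DIM_positive[where 'a='a] assms by linarith
  then have "norm h powr (1 - s - real DIM('a)) \<le> ((1/2) ^ Suc k) powr (1 - s - real DIM('a))"
    using n k by (intro powr_mono2') auto
  moreover have "norm h powr (1 - s - real DIM('a)) = norm h / norm h powr (real DIM('a) + s)"
    using powr_diff[of "norm h" 1 "real DIM('a) + s"] h by (simp add: algebra_simps)
  ultimately show "\<exists>k. norm h \<le> (1/2) ^ k \<and> indicator {h::'a. norm h < 1} h * norm h / norm h powr (real DIM('a) + s)
      \<le> ((1/2) ^ Suc k) powr (1 - s - real DIM('a))"
    using le h by (intro exI[of _ k]) auto
next
  let ?q = "(1/2::real)"
  have "(?q ^ Suc k) powr (1 - s - real DIM('a)) * (?q ^ k) ^ DIM('a) =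
      ?q powr (1 - s - real DIM('a)) * (?q powr (1 - s)) ^ k" for k
  proof -
    have "(?q ^ Suc k) powr (1 - s - real DIM('a)) = ?q powr (1 - s - real DIM('a)) * (?q ^ k) powr (1 - s - real DIM('a))"
      unfolding power_Suc by (rule powr_mult)
    then show ?thesis using dyadic_volume_term[of ?q k "1 - s" "DIM('a)"] by (simp only: mult.assoc)
  qed
  moreover have "summable (\<lambda>k. ?q powr (1 - s - real DIM('a)) * (?q powr (1 - s)) ^ k)"
    using assms by (intro summable_mult summable_geometric) (auto simp: powr01_less_one)
  ultimately show "summable (\<lambda>k. (?q ^ Suc k) powr (1 - s - real DIM('a)) * (?q ^ k) ^ DIM('a))"
    by presburger
qed auto

lemma min_kernel_integrable:
  assumes "0 < s" "s < 1"
  shows "(\<integral>\<^sup>+h. ennreal (min (norm (h::'a::euclidean_space)) 1 / norm h powr (real DIM('a) + s)) \<partial>lborel) < \<infinity>"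
proof -
  have "(\<integral>\<^sup>+h. ennreal (min (norm (h::'a)) 1 / norm h powr (real DIM('a) + s)) \<partial>lborel) =
     (\<integral>\<^sup>+h. ennreal (indicator {h::'a. norm h < 1} h * norm h / norm h powr (real DIM('a) + s)) +
            ennreal (indicator {h::'a. 1 \<le> norm h} h / norm h powr (real DIM('a) + s)) \<partial>lborel)"
    by (intro nn_integral_cong) (auto split: split_indicator)
  also have "\<dots> < \<infinity>"
    using kernel_integrable_far[OF assms(1), where 'a='a] kernel_integrable_near[OF assms, where 'a='a]
    by (subst nn_integral_add) (auto intro!: borel_measurable_divide borel_measurable_times)
  finally show ?thesis .
qed

lemma nn_integral_lborel_product:
  assumes [measurable]: "f \<in> borel_measurable (borel :: ('a::euclidean_space \<times> 'b::euclidean_space) measure)"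
  shows "(\<integral>\<^sup>+p. f p \<partial>lborel) = (\<integral>\<^sup>+x. \<integral>\<^sup>+y. f (x, y) \<partial>lborel \<partial>lborel)"
    and "(\<integral>\<^sup>+p. f p \<partial>lborel) = (\<integral>\<^sup>+y. \<integral>\<^sup>+x. f (x, y) \<partial>lborel \<partial>lborel)"
proof -
  have "f \<in> borel_measurable (lborel \<Otimes>\<^sub>M lborel)" by (simp add: lborel_prod)
  then show "(\<integral>\<^sup>+p. f p \<partial>lborel) = (\<integral>\<^sup>+x. \<integral>\<^sup>+y. f (x, y) \<partial>lborel \<partial>lborel)"
     "(\<integral>\<^sup>+p. f p \<partial>lborel) = (\<integral>\<^sup>+y. \<integral>\<^sup>+x. f (x, y) \<partial>lborel \<partial>lborel)"
    using lborel.nn_integral_fst[of f lborel] lborel_pair.nn_integral_snd[of f]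
    by (simp_all add: lborel_prod case_prod_unfold)
qed

lemma nn_integral_lborel_translation:
  assumes [measurable]: "g \<in> borel_measurable (borel :: ('a::euclidean_space) measure)"
  shows "(\<integral>\<^sup>+y. g (y - x) \<partial>lborel) = (\<integral>\<^sup>+h. g h \<partial>lborel)"
proof -
  have "(\<integral>\<^sup>+h. g h \<partial>lborel) = (\<integral>\<^sup>+h. g h \<partial>(distr lborel borel ((+) (- x))))"
    by (simp add: lborel_distr_plus)
  also have "\<dots> = (\<integral>\<^sup>+y. g (y - x) \<partial>lborel)"
    by (subst nn_integral_distr) auto
  finally show ?thesis by simp
qed

lemma nn_integral_convolution:
  fixes f g :: "'a::euclidean_space \<Rightarrow> ennreal"
  assumes [measurable]: "f \<in> borel_measurable borel" "g \<in> borel_measurable borel"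
  shows "(\<integral>\<^sup>+p. f (fst p) * g (snd p - fst p) \<partial>lborel) = (\<integral>\<^sup>+x. f x \<partial>lborel) * (\<integral>\<^sup>+h. g h \<partial>lborel)"
    and "(\<integral>\<^sup>+p. f (snd p) * g (fst p - snd p) \<partial>lborel) = (\<integral>\<^sup>+x. f x \<partial>lborel) * (\<integral>\<^sup>+h. g h \<partial>lborel)"
proof -
  have "(\<lambda>p. f (fst p) * g (snd p - fst p)) \<in> borel_measurable (borel \<Otimes>\<^sub>M borel)"
       "(\<lambda>p. f (snd p) * g (fst p - snd p)) \<in> borel_measurable (borel \<Otimes>\<^sub>M borel)"
    by measurable
  then have m: "(\<lambda>p. f (fst p) * g (snd p - fst p)) \<in> borel_measurable borel"
       "(\<lambda>p. f (snd p) * g (fst p - snd p)) \<in> borel_measurable borel"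
    unfolding borel_prod .
  have inner: "(\<integral>\<^sup>+y. f x * g (y - x) \<partial>lborel) = f x * (\<integral>\<^sup>+h. g h \<partial>lborel)" for x
    using nn_integral_lborel_translation[of g x] by (simp add: nn_integral_cmult)
  show "(\<integral>\<^sup>+p. f (fst p) * g (snd p - fst p) \<partial>lborel) = (\<integral>\<^sup>+x. f x \<partial>lborel) * (\<integral>\<^sup>+h. g h \<partial>lborel)"
    by (simp add: nn_integral_lborel_product(1)[OF m(1)] inner nn_integral_multc)
  show "(\<integral>\<^sup>+p. f (snd p) * g (fst p - snd p) \<partial>lborel) = (\<integral>\<^sup>+x. f x \<partial>lborel) * (\<integral>\<^sup>+h. g h \<partial>lborel)"
    by (simp add: nn_integral_lborel_product(2)[OF m(2)] inner nn_integral_multc)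
qed

text \<open>A bounded Lipschitz function satisfies \<open>\<bar>\<phi> x - \<phi> y\<bar> \<le> C * min (norm (x - y)) 1\<close>, and the left-hand
  side vanishes unless \<open>x\<close> or \<open>y\<close> lies in a fixed ball. Each of the two cases is a convolution of the
  indicator of the ball with an integrable kernel.\<close>

lemma test_function_energy_finite:
  fixes \<phi> :: "'a::euclidean_space \<Rightarrow> real"
  assumes "\<phi> \<in> test_functions \<Omega>" "0 < s" "s < 1"
  shows "(\<integral>\<^sup>+p. ennreal (\<bar>\<phi> (fst p) - \<phi> (snd p)\<bar> / norm (fst p - snd p) powr (real DIM('a) + s)) \<partial>lebesgue) < \<infinity>"
proof -
  define g where "g h = min (norm (h::'a)) 1 / norm h powr (real DIM('a) + s)" for h
  have [measurable]: "g \<in> borel_measurable borel" unfolding g_def by measurable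
  have g0: "g h \<ge> 0" for h unfolding g_def by simp
  obtain L where L: "L \<ge> 0" "\<And>x y. \<bar>\<phi> x - \<phi> y\<bar> \<le> L * norm (x - y)"
    using test_function_Lipschitz[OF assms(1)] by blast
  obtain M where M: "\<And>x. \<bar>\<phi> x\<bar> \<le> M" using test_function_bounded[OF assms(1)] by blast
  have "bounded (closure {x. \<phi> x \<noteq> 0})"
    using assms(1) compact_imp_bounded unfolding test_functions_def by blast
  then obtain r where "closure {x. \<phi> x \<noteq> 0} \<subseteq> ball 0 r"
    using bounded_subset_ballD by blast
  then have r: "x \<in> ball 0 r" if "\<phi> x \<noteq> 0" for x
    using that closure_subset[of "{x. \<phi> x \<noteq> 0}"] by blast
  define C where "C = max L (2 * M)"
  have "C \<ge> 0" using L unfolding C_def by auto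
  let ?I = "\<integral>\<^sup>+h. ennreal (g h) \<partial>lborel"
  have I: "?I < \<infinity>" unfolding g_def by (rule min_kernel_integrable[OF assms(2,3)])
  have pt: "\<bar>\<phi> x - \<phi> y\<bar> / norm (x - y) powr (real DIM('a) + s) \<le>
      C * (indicator (ball 0 r) x * g (y - x) + indicator (ball 0 r) y * g (x - y))" for x y
  proof (cases "\<phi> x = 0 \<and> \<phi> y = 0")
    case True
    then show ?thesis using \<open>C \<ge> 0\<close> g0 by auto
  next
    case False
    have "\<bar>\<phi> x - \<phi> y\<bar> \<le> 2 * M" using M[of x] M[of y] by linarith
    then have "\<bar>\<phi> x - \<phi> y\<bar> \<le> C * 1" unfolding C_def by linarith
    moreover have "\<bar>\<phi> x - \<phi> y\<bar> \<le> C * norm (x - y)"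
      using L(2)[of x y] unfolding C_def by (smt (verit) mult_right_mono norm_ge_zero)
    ultimately have "\<bar>\<phi> x - \<phi> y\<bar> \<le> C * min (norm (x - y)) 1" by (simp add: min_def)
    then have "\<bar>\<phi> x - \<phi> y\<bar> / norm (x - y) powr (real DIM('a) + s) \<le> C * g (x - y)"
      unfolding g_def by (simp add: divide_right_mono)
    moreover have "g (y - x) = g (x - y)" unfolding g_def by (simp add: norm_minus_commute)
    moreover have "g (x - y) \<le> indicator (ball 0 r) x * g (x - y) + indicator (ball 0 r) y * g (x - y)"
      using False r g0[of "x - y"] by (auto split: split_indicator)
    ultimately show ?thesis using \<open>C \<ge> 0\<close> by (smt (verit) mult_left_mono)
  qed
  have "(\<integral>\<^sup>+p. ennreal (\<bar>\<phi> (fst p) - \<phi> (snd p)\<bar> / norm (fst p - snd p) powr (real DIM('a) + s)) \<partial>lborel)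
      \<le> (\<integral>\<^sup>+p. ennreal C * (indicator (ball 0 r) (fst p) * ennreal (g (snd p - fst p)) +
               indicator (ball 0 r) (snd p) * ennreal (g (fst p - snd p))) \<partial>lborel)"
  proof (intro nn_integral_mono)
    fix p :: "'a \<times> 'a"
    have "ennreal (\<bar>\<phi> (fst p) - \<phi> (snd p)\<bar> / norm (fst p - snd p) powr (real DIM('a) + s)) \<le>
       ennreal (C * (indicator (ball 0 r) (fst p) * g (snd p - fst p) + indicator (ball 0 r) (snd p) * g (fst p - snd p)))"
      using pt by (intro ennreal_leI)
    also have "\<dots> = ennreal C * (indicator (ball 0 r) (fst p) * ennreal (g (snd p - fst p)) +
               indicator (ball 0 r) (snd p) * ennreal (g (fst p - snd p)))"
      using \<open>C \<ge> 0\<close> g0 by (auto simp: ennreal_mult ennreal_plus split: split_indicator)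
    finally show "ennreal (\<bar>\<phi> (fst p) - \<phi> (snd p)\<bar> / norm (fst p - snd p) powr (real DIM('a) + s)) \<le> \<dots>" .
  qed
  also have "\<dots> = ennreal C * (emeasure lborel (ball (0::'a) r) * ?I + emeasure lborel (ball (0::'a) r) * ?I)"
  proof -
    let ?f = "\<lambda>p::'a \<times> 'a. indicator (ball 0 r) (fst p) * ennreal (g (snd p - fst p))"
    let ?h = "\<lambda>p::'a \<times> 'a. indicator (ball 0 r) (snd p) * ennreal (g (fst p - snd p))"
    have [measurable]: "(indicator (ball 0 r) :: 'a \<Rightarrow> ennreal) \<in> borel_measurable borel"
      by (simp add: borel_measurable_indicator)
    have "?f \<in> borel_measurable (borel \<Otimes>\<^sub>M borel)" "?h \<in> borel_measurable (borel \<Otimes>\<^sub>M borel)"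
      by (auto intro!: borel_measurable_times_ennreal measurable_compose[OF measurable_fst] measurable_compose[OF measurable_snd])
    then have m: "?f \<in> borel_measurable lborel" "?h \<in> borel_measurable lborel"
      by (simp_all add: borel_prod)
    have "(\<integral>\<^sup>+p. ennreal C * (?f p + ?h p) \<partial>lborel) = ennreal C * ((\<integral>\<^sup>+p. ?f p \<partial>lborel) + (\<integral>\<^sup>+p. ?h p \<partial>lborel))"
      using m by (simp only: nn_integral_cmult nn_integral_add borel_measurable_add)
    also have "(\<integral>\<^sup>+p. ?f p \<partial>lborel) = emeasure lborel (ball (0::'a) r) * ?I"
      by (subst nn_integral_convolution(1)) auto
    also have "(\<integral>\<^sup>+p. ?h p \<partial>lborel) = emeasure lborel (ball (0::'a) r) * ?I"
      by (subst nn_integral_convolution(2)) auto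
    finally show ?thesis .
  qed
  also have "\<dots> < \<infinity>"
    using I emeasure_lborel_ball_finite[of "0::'a" r] by (auto simp: ennreal_mult_less_top)
  finally show ?thesis by (simp add: nn_integral_completion)
qed

section \<open>Gagliardo quotients and convergence in the Sobolev norm\<close>

text \<open>Dominated convergence with the majorants \<open>e j + G\<close>, which vary with \<open>j\<close> but whose varying part tends to
  \<open>0\<close> in mean: \<open>min (D j) G\<close> is dominated by \<open>G\<close>, and \<open>e j\<close> takes care of the rest.\<close>

lemma nn_integral_tendsto_0_dominated:
  fixes D e :: "nat \<Rightarrow> 'a \<Rightarrow> ennreal"
  assumes [measurable]: "\<And>j. D j \<in> borel_measurable M" "\<And>j. e j \<in> borel_measurable M" "G \<in> borel_measurable M"
    and lim: "AE x in M. (\<lambda>j. D j x) \<longlonglongrightarrow> 0"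
    and bound: "\<And>j. AE x in M. D j x \<le> e j x + G x"
    and e: "(\<lambda>j. \<integral>\<^sup>+x. e j x \<partial>M) \<longlonglongrightarrow> 0"
    and G: "(\<integral>\<^sup>+x. G x \<partial>M) < \<infinity>"
  shows "(\<lambda>j. \<integral>\<^sup>+x. D j x \<partial>M) \<longlonglongrightarrow> 0"
proof -
  have "(\<lambda>j. \<integral>\<^sup>+x. min (D j x) (G x) \<partial>M) \<longlonglongrightarrow> (\<integral>\<^sup>+x. 0 \<partial>M)"
  proof (rule nn_integral_dominated_convergence[where w=G])
    show "AE x in M. (\<lambda>j. min (D j x) (G x)) \<longlonglongrightarrow> 0"
      using lim
    proof eventually_elim
      case (elim x)
      show ?case by (rule tendsto_sandwich[OF _ _ tendsto_const elim]) auto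
    qed
  qed (use G in auto)
  then have upper: "(\<lambda>j. (\<integral>\<^sup>+x. min (D j x) (G x) \<partial>M) + (\<integral>\<^sup>+x. e j x \<partial>M)) \<longlonglongrightarrow> 0"
    using tendsto_add[OF _ e] by fastforce
  have le: "(\<integral>\<^sup>+x. D j x \<partial>M) \<le> (\<integral>\<^sup>+x. min (D j x) (G x) \<partial>M) + (\<integral>\<^sup>+x. e j x \<partial>M)" for j
  proof -
    have "(\<integral>\<^sup>+x. D j x \<partial>M) \<le> (\<integral>\<^sup>+x. min (D j x) (G x) + e j x \<partial>M)"
      using bound[of j]
      by (intro nn_integral_mono_AE) (auto simp: min_def add.commute add_increasing2 elim!: eventually_mono)
    then show ?thesis by (simp add: nn_integral_add)
  qed
  show ?thesis
    by (rule tendsto_sandwich[OF always_eventually always_eventually tendsto_const upper]) (use le in auto)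
qed

text \<open>Used to pass from convergence in mean at a geometric rate to convergence almost everywhere.\<close>

lemma AE_tendsto_0_if_summable_nn_integral:
  fixes d :: "nat \<Rightarrow> 'a \<Rightarrow> real"
  assumes [measurable]: "\<And>j. d j \<in> borel_measurable M"
    and fin: "(\<Sum>j. \<integral>\<^sup>+x. ennreal \<bar>d j x\<bar> \<partial>M) < \<infinity>"
  shows "AE x in M. (\<lambda>j. d j x) \<longlonglongrightarrow> 0"
proof -
  have "(\<integral>\<^sup>+x. (\<Sum>j. ennreal \<bar>d j x\<bar>) \<partial>M) \<noteq> \<infinity>"
    using fin by (simp add: nn_integral_suminf)
  then have "AE x in M. (\<Sum>j. ennreal \<bar>d j x\<bar>) \<noteq> \<infinity>"
    by (intro nn_integral_PInf_AE) measurable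
  then show ?thesis
  proof eventually_elim
    case (elim x)
    then have "summable (\<lambda>j. \<bar>d j x\<bar>)"
      by (intro summable_suminf_not_top) auto
    then show ?case using summable_LIMSEQ_zero tendsto_rabs_zero_iff by blast
  qed
qed

lemma null_sets_Times_UNIV:
  fixes N :: "'a::euclidean_space set"
  assumes "N \<in> null_sets lborel"
  shows "N \<times> (UNIV :: 'b::euclidean_space set) \<in> null_sets lborel"
    and "(UNIV :: 'b set) \<times> N \<in> null_sets lborel"
proof -
  have N: "N \<in> sets lborel" "emeasure lborel N = 0" using assms by auto
  have "N \<times> (UNIV :: 'b set) \<in> null_sets (lborel \<Otimes>\<^sub>M lborel)"
    using N by (intro null_setsI) (simp_all add: lborel.emeasure_pair_measure_Times pair_measureI)
  then show "N \<times> (UNIV :: 'b set) \<in> null_sets lborel" by (simp only: lborel_prod)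
  have "(UNIV :: 'b set) \<times> N \<in> null_sets (lborel \<Otimes>\<^sub>M lborel)"
    using N by (intro null_setsI) (simp_all add: lborel.emeasure_pair_measure_Times pair_measureI)
  then show "(UNIV :: 'b set) \<times> N \<in> null_sets lborel" by (simp only: lborel_prod)
qed

lemma AE_lebesgue_fst_snd:
  assumes "AE x in (lebesgue :: 'a::euclidean_space measure). P x"
  shows "AE p in (lebesgue :: ('a \<times> 'b::euclidean_space) measure). P (fst p)"
    and "AE p in (lebesgue :: ('b \<times> 'a) measure). P (snd p)"
proof -
  obtain N where N: "\<And>x. x \<notin> N \<Longrightarrow> P x" "N \<in> null_sets lborel"
    by (rule AE_E3[OF assms[unfolded AE_completion_iff]]) auto
  have N': "x \<in> N" if "\<not> P x" for x using N(1) that by metis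
  have "AE p in (lborel :: ('a \<times> 'b) measure). P (fst p)"
    by (rule AE_I'[OF null_sets_Times_UNIV(1)[OF N(2)]]) (auto simp: N' mem_Times_iff)
  then show "AE p in (lebesgue :: ('a \<times> 'b) measure). P (fst p)" by (rule AE_completion)
  have "AE p in (lborel :: ('b \<times> 'a) measure). P (snd p)"
    by (rule AE_I'[OF null_sets_Times_UNIV(2)[OF N(2)]]) (auto simp: N' mem_Times_iff)
  then show "AE p in (lebesgue :: ('b \<times> 'a) measure). P (snd p)" by (rule AE_completion)
qed

text \<open>Measurability for the completed measures requires the preimages of null sets to be null, which
  holds for projections because a null set times the whole space is null.\<close>

lemma measurable_lebesgue_fst_snd:
  "fst \<in> (lebesgue :: ('a::euclidean_space \<times> 'b::euclidean_space) measure) \<rightarrow>\<^sub>M lebesgue"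
  "snd \<in> (lebesgue :: ('a \<times> 'b) measure) \<rightarrow>\<^sub>M lebesgue"
proof -
  have "fst \<in> (borel \<Otimes>\<^sub>M borel :: ('a \<times> 'b) measure) \<rightarrow>\<^sub>M borel"
    "snd \<in> (borel \<Otimes>\<^sub>M borel :: ('a \<times> 'b) measure) \<rightarrow>\<^sub>M borel" by measurable
  then have m: "fst \<in> (lebesgue :: ('a \<times> 'b) measure) \<rightarrow>\<^sub>M lborel"
    "snd \<in> (lebesgue :: ('a \<times> 'b) measure) \<rightarrow>\<^sub>M lborel"
    by (auto simp: borel_prod intro: measurable_completion)
  have "N \<in> null_sets (distr lebesgue lborel (fst :: 'a \<times> 'b \<Rightarrow> 'a))" if "N \<in> null_sets lborel" for N
  proof -
    have "fst -` N \<inter> space lebesgue = N \<times> (UNIV :: 'b set)" by auto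
    moreover have "N \<times> (UNIV :: 'b set) \<in> null_sets lebesgue"
      using null_sets_completionI null_sets_Times_UNIV(1)[OF that] by blast
    ultimately show ?thesis using m(1) null_setsD2[OF that] by (simp add: null_sets_distr_iff)
  qed
  then show "fst \<in> (lebesgue :: ('a \<times> 'b) measure) \<rightarrow>\<^sub>M lebesgue"
    by (intro completion.measurable_completion2[OF m(1)] subsetI)
  have "N \<in> null_sets (distr lebesgue lborel (snd :: 'a \<times> 'b \<Rightarrow> 'b))" if "N \<in> null_sets lborel" for N
  proof -
    have "snd -` N \<inter> space lebesgue = (UNIV :: 'a set) \<times> N" by auto
    moreover have "(UNIV :: 'a set) \<times> N \<in> null_sets lebesgue"
      using null_sets_completionI null_sets_Times_UNIV(2)[OF that] by blast
    ultimately show ?thesis using m(2) null_setsD2[OF that] by (simp add: null_sets_distr_iff)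
  qed
  then show "snd \<in> (lebesgue :: ('a \<times> 'b) measure) \<rightarrow>\<^sub>M lebesgue"
    by (intro completion.measurable_completion2[OF m(2)] subsetI)
qed

definition gagliardo :: "real \<Rightarrow> ('a::euclidean_space \<Rightarrow> real) \<Rightarrow> 'a \<times> 'a \<Rightarrow> real" where
  "gagliardo s u p = \<bar>u (fst p) - u (snd p)\<bar> / norm (fst p - snd p) powr (real DIM('a) + s)"

lemma borel_measurable_lebesgue_kernel [measurable]:
  "(\<lambda>p::'a::euclidean_space \<times> 'a. norm (fst p - snd p) powr a) \<in> borel_measurable lebesgue"
proof -
  have "(\<lambda>p::'a \<times> 'a. norm (fst p - snd p) powr a) \<in> borel_measurable (borel \<Otimes>\<^sub>M borel)" by measurable
  then show ?thesis by (auto simp: borel_prod intro: measurable_completion)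
qed

lemma borel_measurable_gagliardo [measurable]:
  assumes u: "u \<in> borel_measurable lebesgue"
  shows "gagliardo s u \<in> borel_measurable lebesgue"
proof -
  have fst: "(\<lambda>p. u (fst p)) \<in> borel_measurable lebesgue"
    by (rule measurable_compose[OF measurable_lebesgue_fst_snd(1) u])
  have snd: "(\<lambda>p. u (snd p)) \<in> borel_measurable lebesgue"
    by (rule measurable_compose[OF measurable_lebesgue_fst_snd(2) u])
  have "(\<lambda>p. \<bar>u (fst p) - u (snd p)\<bar> / norm (fst p - snd p) powr (real DIM('a) + s)) \<in> borel_measurable lebesgue"
    by (rule borel_measurable_divide[OF borel_measurable_abs[OF borel_measurable_diff[OF fst snd]]
          borel_measurable_lebesgue_kernel])
  then show ?thesis unfolding gagliardo_def[abs_def] .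
qed

lemma gagliardo_nonneg [simp]: "0 \<le> gagliardo s u p"
  unfolding gagliardo_def by simp

lemma gagliardo_mono:
  assumes "\<bar>w (fst p) - w (snd p)\<bar> \<le> C * (\<bar>a (fst p) - a (snd p)\<bar> + \<bar>b (fst p) - b (snd p)\<bar>)"
  shows "gagliardo s w p \<le> C * (gagliardo s a p + gagliardo s b p)"
  using divide_right_mono[OF assms, of "norm (fst p - snd p) powr (real DIM('a) + s)"]
  unfolding gagliardo_def by (simp add: add_divide_distrib distrib_left)

lemma gagliardo_triangle: "gagliardo s a p \<le> gagliardo s (\<lambda>x. a x - b x) p + gagliardo s b p"
  using gagliardo_mono[of a p 1 "\<lambda>x. a x - b x" b s] by (simp add: abs_triangle_ineq4)

lemma gagliardo_diff_le: "gagliardo s (\<lambda>x. a x - b x) p \<le> gagliardo s a p + gagliardo s b p"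
  using gagliardo_mono[of "\<lambda>x. a x - b x" p 1 a b s] by simp

lemma Ws1_norm_gagliardo:
  "Ws1_norm s \<Omega> u = (\<integral>\<^sup>+x. ennreal \<bar>u x\<bar> * indicator \<Omega> x \<partial>lebesgue)
     + (\<integral>\<^sup>+p. ennreal (gagliardo s u p) * indicator (\<Omega> \<times> \<Omega>) p \<partial>lebesgue)"
  unfolding Ws1_norm_def gagliardo_def ..

lemma borel_measurable_test_function:
  "\<phi> \<in> test_functions \<Omega> \<Longrightarrow> \<phi> \<in> borel_measurable lebesgue"
  using borel_measurable_continuous_onI[of \<phi>] measurable_completion[of \<phi> lborel borel] C_k.simps(1)
  unfolding test_functions_def by fastforce

lemma sets_lebesgue_Times:
  assumes "A \<in> sets lebesgue" "B \<in> sets lebesgue"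
  shows "A \<times> B \<in> sets (lebesgue :: ('a::euclidean_space \<times> 'b::euclidean_space) measure)"
proof -
  have "fst -` A \<inter> space lebesgue \<in> sets (lebesgue :: ('a \<times> 'b) measure)"
       "snd -` B \<inter> space lebesgue \<in> sets (lebesgue :: ('a \<times> 'b) measure)"
    by (rule measurable_sets[OF measurable_lebesgue_fst_snd(1) assms(1)], rule measurable_sets[OF measurable_lebesgue_fst_snd(2) assms(2)])
  then have "(fst -` A \<inter> space lebesgue) \<inter> (snd -` B \<inter> space lebesgue) \<in> sets (lebesgue :: ('a \<times> 'b) measure)"
    by (rule sets.Int)
  moreover have "(fst -` A \<inter> space lebesgue) \<inter> (snd -` B \<inter> space (lebesgue :: ('a \<times> 'b) measure)) = A \<times> B" by auto
  ultimately show ?thesis by metis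
qed

text \<open>Functions \<open>F j\<close> obtained from \<open>a j\<close> and \<open>b\<close> by a Lipschitz operation converge in the Sobolev norm
  as soon as \<open>a j\<close> does and \<open>F j\<close> converges pointwise. A Lipschitz map does not satisfy a Lipschitz
  estimate in this norm; instead, the Gagliardo quotients of \<open>F' - F j\<close> are bounded by those of
  \<open>a' - a j\<close>, which tend to \<open>0\<close> in mean, plus a fixed integrable function.\<close>

lemma Ws1_norm_composition_tendsto:
  fixes F a :: "nat \<Rightarrow> 'a::euclidean_space \<Rightarrow> real"
  assumes \<Omega>[measurable]: "\<Omega> \<in> sets lebesgue" and fin: "emeasure lebesgue \<Omega> < \<infinity>"
    and [measurable]: "\<And>j. F j \<in> borel_measurable lebesgue" "F' \<in> borel_measurable lebesgue"
      "\<And>j. a j \<in> borel_measurable lebesgue" "a' \<in> borel_measurable lebesgue" "b \<in> borel_measurable lebesgue"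
    and lim: "AE x in lebesgue. x \<in> \<Omega> \<longrightarrow> (\<lambda>j. a j x) \<longlonglongrightarrow> a' x \<and> (\<lambda>j. F j x) \<longlonglongrightarrow> F' x"
    and bd: "\<And>j x. \<bar>F j x\<bar> \<le> 1"
    and C: "0 \<le> C" and lip: "\<And>j x y. \<bar>F j x - F j y\<bar> \<le> C * (\<bar>a j x - a j y\<bar> + \<bar>b x - b y\<bar>)"
    and conv: "(\<lambda>j. Ws1_norm s \<Omega> (\<lambda>x. a' x - a j x)) \<longlonglongrightarrow> 0"
    and Ea: "(\<integral>\<^sup>+p. ennreal (gagliardo s a' p) * indicator (\<Omega> \<times> \<Omega>) p \<partial>lebesgue) < \<infinity>"
    and Eb: "(\<integral>\<^sup>+p. ennreal (gagliardo s b p) * indicator (\<Omega> \<times> \<Omega>) p \<partial>lebesgue) < \<infinity>"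
  shows "(\<lambda>j. Ws1_norm s \<Omega> (\<lambda>x. F' x - F j x)) \<longlonglongrightarrow> 0"
proof -
  have [measurable]: "\<Omega> \<times> \<Omega> \<in> sets lebesgue" by (intro sets_lebesgue_Times \<Omega>)
  have bd': "AE x in lebesgue. x \<in> \<Omega> \<longrightarrow> \<bar>F' x\<bar> \<le> 1"
    using lim
  proof eventually_elim
    case (elim x)
    show ?case
    proof
      assume "x \<in> \<Omega>"
      then have "(\<lambda>j. \<bar>F j x\<bar>) \<longlonglongrightarrow> \<bar>F' x\<bar>" using elim by (intro tendsto_rabs) simp
      then show "\<bar>F' x\<bar> \<le> 1" by (rule LIMSEQ_le_const2) (simp add: bd)
    qed
  qed
  have L1: "(\<lambda>j. \<integral>\<^sup>+x. ennreal \<bar>F' x - F j x\<bar> * indicator \<Omega> x \<partial>lebesgue) \<longlonglongrightarrow> 0"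
  proof (rule nn_integral_tendsto_0_dominated[where e="\<lambda>j x. 0" and G="\<lambda>x. 2 * indicator \<Omega> x"])
    show "AE x in lebesgue. (\<lambda>j. ennreal \<bar>F' x - F j x\<bar> * indicator \<Omega> x) \<longlonglongrightarrow> 0"
      using lim
    proof eventually_elim
      case (elim x)
      have "(\<lambda>j. ennreal \<bar>F' x - F j x\<bar>) \<longlonglongrightarrow> ennreal \<bar>F' x - F' x\<bar>" if "x \<in> \<Omega>"
        using elim that by (intro tendsto_ennrealI tendsto_intros) auto
      then show ?case by (auto split: split_indicator)
    qed
    show "AE x in lebesgue. ennreal \<bar>F' x - F j x\<bar> * indicator \<Omega> x \<le> 0 + 2 * indicator \<Omega> x" for j
      using bd'
    proof eventually_elim
      case (elim x)
      then show ?case using bd[of j x]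
        by (auto split: split_indicator simp flip: ennreal_numeral intro!: ennreal_leI)
    qed
  qed (use fin in \<open>auto simp: nn_integral_cmult ennreal_mult_less_top\<close>)
  have "(\<lambda>j. \<integral>\<^sup>+p. ennreal (gagliardo s (\<lambda>x. F' x - F j x) p) * indicator (\<Omega> \<times> \<Omega>) p \<partial>lebesgue) \<longlonglongrightarrow> 0"
  proof (rule nn_integral_tendsto_0_dominated
      [where e="\<lambda>j p. ennreal C * (ennreal (gagliardo s (\<lambda>x. a' x - a j x) p) * indicator (\<Omega> \<times> \<Omega>) p)"
         and G="\<lambda>p. ennreal (2 * C) * (ennreal (gagliardo s a' p) * indicator (\<Omega> \<times> \<Omega>) p +
                    ennreal (gagliardo s b p) * indicator (\<Omega> \<times> \<Omega>) p)"])
    have lim2: "AE p in lebesgue. (fst p \<in> \<Omega> \<longrightarrow> (\<lambda>j. a j (fst p)) \<longlonglongrightarrow> a' (fst p) \<and> (\<lambda>j. F j (fst p)) \<longlonglongrightarrow> F' (fst p)) \<and>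
        (snd p \<in> \<Omega> \<longrightarrow> (\<lambda>j. a j (snd p)) \<longlonglongrightarrow> a' (snd p) \<and> (\<lambda>j. F j (snd p)) \<longlonglongrightarrow> F' (snd p))"
      by (intro AE_conjI) (use AE_lebesgue_fst_snd[OF lim] in auto)
    then show "AE p in lebesgue. (\<lambda>j. ennreal (gagliardo s (\<lambda>x. F' x - F j x) p) * indicator (\<Omega> \<times> \<Omega>) p) \<longlonglongrightarrow> 0"
    proof eventually_elim
      case (elim p)
      have "(\<lambda>j. ennreal (gagliardo s (\<lambda>x. F' x - F j x) p)) \<longlonglongrightarrow>
         ennreal (\<bar>(F' (fst p) - F' (fst p)) - (F' (snd p) - F' (snd p))\<bar> * inverse (norm (fst p - snd p) powr (real DIM('a) + s)))" if "p \<in> \<Omega> \<times> \<Omega>"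
        unfolding gagliardo_def divide_inverse
        using elim that by (intro tendsto_ennrealI tendsto_intros) auto
      then show ?case by (auto split: split_indicator)
    qed
    fix j
    show "AE p in lebesgue. ennreal (gagliardo s (\<lambda>x. F' x - F j x) p) * indicator (\<Omega> \<times> \<Omega>) p
        \<le> ennreal C * (ennreal (gagliardo s (\<lambda>x. a' x - a j x) p) * indicator (\<Omega> \<times> \<Omega>) p) +
          ennreal (2 * C) * (ennreal (gagliardo s a' p) * indicator (\<Omega> \<times> \<Omega>) p +
                    ennreal (gagliardo s b p) * indicator (\<Omega> \<times> \<Omega>) p)"
      using lim2
    proof eventually_elim
      case (elim p)
      show ?case
      proof (cases "p \<in> \<Omega> \<times> \<Omega>")
        case True
        then have "\<bar>F' (fst p) - F' (snd p)\<bar> \<le> C * (\<bar>a' (fst p) - a' (snd p)\<bar> + \<bar>b (fst p) - b (snd p)\<bar>)"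
        proof -
          have "(\<lambda>j. \<bar>F j (fst p) - F j (snd p)\<bar>) \<longlonglongrightarrow> \<bar>F' (fst p) - F' (snd p)\<bar>"
            using elim True by (intro tendsto_intros) auto
          moreover have "(\<lambda>j. C * (\<bar>a j (fst p) - a j (snd p)\<bar> + \<bar>b (fst p) - b (snd p)\<bar>)) \<longlonglongrightarrow>
              C * (\<bar>a' (fst p) - a' (snd p)\<bar> + \<bar>b (fst p) - b (snd p)\<bar>)"
            using elim True by (intro tendsto_intros) auto
          ultimately show ?thesis by (rule LIMSEQ_le) (use lip in blast)
        qed
        then have 1: "gagliardo s F' p \<le> C * (gagliardo s a' p + gagliardo s b p)" by (rule gagliardo_mono)
        have "gagliardo s (F j) p \<le> C * (gagliardo s (a j) p + gagliardo s b p)"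
          by (rule gagliardo_mono) (rule lip)
        also have "gagliardo s (a j) p \<le> gagliardo s (\<lambda>x. a' x - a j x) p + gagliardo s a' p"
          using gagliardo_triangle[of s "a j" p a'] by (simp add: gagliardo_def abs_minus_commute algebra_simps)
        finally have "gagliardo s (F j) p \<le> C * (gagliardo s (\<lambda>x. a' x - a j x) p + gagliardo s a' p + gagliardo s b p)"
          using C by (simp add: mult_left_mono)
        with 1 gagliardo_diff_le[of s F' "F j" p]
        have "gagliardo s (\<lambda>x. F' x - F j x) p \<le> C * gagliardo s (\<lambda>x. a' x - a j x) p + 2 * C * (gagliardo s a' p + gagliardo s b p)"
          by (simp add: algebra_simps)
        then have "ennreal (gagliardo s (\<lambda>x. F' x - F j x) p) \<le>
            ennreal (C * gagliardo s (\<lambda>x. a' x - a j x) p + 2 * C * (gagliardo s a' p + gagliardo s b p))"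
          by (rule ennreal_leI)
        also have "\<dots> = ennreal C * ennreal (gagliardo s (\<lambda>x. a' x - a j x) p) +
          ennreal (2 * C) * (ennreal (gagliardo s a' p) + ennreal (gagliardo s b p))"
          using C by (simp only: ennreal_plus ennreal_mult gagliardo_nonneg add_nonneg_nonneg mult_nonneg_nonneg zero_le_numeral)
        finally show ?thesis using True by simp
      qed simp
    qed
    have "(\<lambda>j. \<integral>\<^sup>+p. ennreal (gagliardo s (\<lambda>x. a' x - a j x) p) * indicator (\<Omega> \<times> \<Omega>) p \<partial>lebesgue) \<longlonglongrightarrow> 0"
      by (rule tendsto_sandwich[OF _ _ tendsto_const conv]) (auto simp: Ws1_norm_gagliardo add_increasing)
    then have "(\<lambda>j. ennreal C * (\<integral>\<^sup>+p. ennreal (gagliardo s (\<lambda>x. a' x - a j x) p) * indicator (\<Omega> \<times> \<Omega>) p \<partial>lebesgue)) \<longlonglongrightarrow> ennreal C * 0"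
      by (intro tendsto_mult_ennreal) auto
    then show "(\<lambda>j. \<integral>\<^sup>+p. ennreal C * (ennreal (gagliardo s (\<lambda>x. a' x - a j x) p) * indicator (\<Omega> \<times> \<Omega>) p) \<partial>lebesgue) \<longlonglongrightarrow> 0"
      by (simp add: nn_integral_cmult)
  next
    show "(\<integral>\<^sup>+p. ennreal (2 * C) * (ennreal (gagliardo s a' p) * indicator (\<Omega> \<times> \<Omega>) p +
                    ennreal (gagliardo s b p) * indicator (\<Omega> \<times> \<Omega>) p) \<partial>lebesgue) < \<infinity>"
      using Ea Eb by (simp add: nn_integral_cmult nn_integral_add ennreal_mult_less_top)
  qed measurable
  then show ?thesis unfolding Ws1_norm_gagliardo using tendsto_add[OF L1] by fastforce
qed

section \<open>Testing the equation with truncations of the solution\<close>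

lemma Ws1_0_approximation:
  assumes "u \<in> Ws1_0 s \<Omega>" and [measurable]: "\<Omega> \<in> sets lebesgue"
  shows "\<exists>\<phi>. (\<forall>j. \<phi> j \<in> test_functions \<Omega>) \<and> (\<forall>j. Ws1_norm s \<Omega> (\<lambda>x. u x - \<phi> j x) < \<infinity>) \<and>
    (\<lambda>j. Ws1_norm s \<Omega> (\<lambda>x. u x - \<phi> j x)) \<longlonglongrightarrow> 0 \<and>
    (AE x in lebesgue. x \<in> \<Omega> \<longrightarrow> (\<lambda>j. \<phi> j x) \<longlonglongrightarrow> u x)"
proof -
  have [measurable]: "u \<in> borel_measurable lebesgue" using assms(1) unfolding Ws1_0_def by auto
  have "\<exists>\<phi>\<in>test_functions \<Omega>. Ws1_norm s \<Omega> (\<lambda>x. u x - \<phi> x) < ennreal ((1/2) ^ j)" for j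
    using assms(1) unfolding Ws1_0_def by auto
  then obtain \<phi> where \<phi>: "\<And>j. \<phi> j \<in> test_functions \<Omega>"
    and lt: "\<And>j. Ws1_norm s \<Omega> (\<lambda>x. u x - \<phi> j x) < ennreal ((1/2) ^ j)" by metis
  have [measurable]: "\<phi> j \<in> borel_measurable lebesgue" for j
    using \<phi> borel_measurable_test_function by blast
  have "(\<lambda>j. ennreal ((1/2) ^ j)) \<longlonglongrightarrow> ennreal 0"
    by (intro tendsto_ennrealI LIMSEQ_realpow_zero) auto
  then have z: "(\<lambda>j. ennreal ((1/2) ^ j)) \<longlonglongrightarrow> 0" by simp
  have 2: "(\<lambda>j. Ws1_norm s \<Omega> (\<lambda>x. u x - \<phi> j x)) \<longlonglongrightarrow> 0"
    by (rule tendsto_sandwich[OF always_eventually always_eventually tendsto_const z])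
       (use lt less_imp_le in auto)
  have 3: "Ws1_norm s \<Omega> (\<lambda>x. u x - \<phi> j x) < \<infinity>" for j
    by (rule less_trans[OF lt]) simp
  have L1: "(\<integral>\<^sup>+x. ennreal \<bar>(u x - \<phi> j x) * indicator \<Omega> x\<bar> \<partial>lebesgue) \<le> ennreal ((1/2) ^ j)" for j
  proof -
    have "(\<integral>\<^sup>+x. ennreal \<bar>(u x - \<phi> j x) * indicator \<Omega> x\<bar> \<partial>lebesgue) =
        (\<integral>\<^sup>+x. ennreal \<bar>u x - \<phi> j x\<bar> * indicator \<Omega> x \<partial>lebesgue)"
      by (intro nn_integral_cong) (auto split: split_indicator)
    also have "\<dots> \<le> Ws1_norm s \<Omega> (\<lambda>x. u x - \<phi> j x)" unfolding Ws1_norm_gagliardo by simp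
    finally show ?thesis using lt[of j] by simp
  qed
  have "(\<Sum>j. \<integral>\<^sup>+x. ennreal \<bar>(u x - \<phi> j x) * indicator \<Omega> x\<bar> \<partial>lebesgue) \<le> (\<Sum>j. ennreal ((1/2) ^ j))"
    by (intro suminf_le L1) auto
  also have "\<dots> = ennreal (\<Sum>j. (1/2) ^ j)"
    by (intro suminf_ennreal2 summable_geometric) auto
  also have "\<dots> < \<infinity>" by simp
  finally have "(\<Sum>j. \<integral>\<^sup>+x. ennreal \<bar>(u x - \<phi> j x) * indicator \<Omega> x\<bar> \<partial>lebesgue) < \<infinity>" .
  then have "AE x in lebesgue. (\<lambda>j. (u x - \<phi> j x) * indicator \<Omega> x) \<longlonglongrightarrow> 0"
    by (intro AE_tendsto_0_if_summable_nn_integral) measurable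
  then have "AE x in lebesgue. x \<in> \<Omega> \<longrightarrow> (\<lambda>j. \<phi> j x) \<longlonglongrightarrow> u x"
  proof eventually_elim
    case (elim x)
    show ?case
    proof
      assume "x \<in> \<Omega>"
      then have "(\<lambda>j. u x - (u x - \<phi> j x)) \<longlonglongrightarrow> u x - 0" using elim by (intro tendsto_diff) auto
      then show "(\<lambda>j. \<phi> j x) \<longlonglongrightarrow> u x" by simp
    qed
  qed
  then show ?thesis using \<phi> 2 3 by blast
qed

lemma Ws1_0_energy_finite:
  fixes u :: "'a::euclidean_space \<Rightarrow> real"
  assumes "u \<in> Ws1_0 s \<Omega>" and \<Omega>: "\<Omega> \<in> sets lebesgue" and s: "0 < s" "s < 1"
  shows "(\<integral>\<^sup>+p. ennreal (gagliardo s u p) * indicator (\<Omega> \<times> \<Omega>) p \<partial>lebesgue) < \<infinity>"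
proof -
  obtain \<phi> :: "nat \<Rightarrow> 'a \<Rightarrow> real" where \<phi>: "\<And>j. \<phi> j \<in> test_functions \<Omega>"
    and fin: "\<And>j. Ws1_norm s \<Omega> (\<lambda>x. u x - \<phi> j x) < \<infinity>"
    using Ws1_0_approximation[OF assms(1) \<Omega>] by blast
  have [measurable]: "\<phi> 0 \<in> borel_measurable lebesgue" "u \<in> borel_measurable lebesgue"
    using \<phi> borel_measurable_test_function assms(1) unfolding Ws1_0_def by blast+
  have [measurable]: "\<Omega> \<times> \<Omega> \<in> sets lebesgue" by (intro sets_lebesgue_Times \<Omega>)
  have "(\<integral>\<^sup>+p. ennreal (gagliardo s u p) * indicator (\<Omega> \<times> \<Omega>) p \<partial>lebesgue) \<le>
    (\<integral>\<^sup>+p. ennreal (gagliardo s (\<lambda>x. u x - \<phi> 0 x) p) * indicator (\<Omega> \<times> \<Omega>) p + ennreal (gagliardo s (\<phi> 0) p) \<partial>lebesgue)"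
  proof (intro nn_integral_mono)
    fix p
    show "ennreal (gagliardo s u p) * indicator (\<Omega> \<times> \<Omega>) p \<le>
        ennreal (gagliardo s (\<lambda>x. u x - \<phi> 0 x) p) * indicator (\<Omega> \<times> \<Omega>) p + ennreal (gagliardo s (\<phi> 0) p)"
      using ennreal_leI[OF gagliardo_triangle[of s u p "\<phi> 0"]] by (auto split: split_indicator)
  qed
  also have "\<dots> = (\<integral>\<^sup>+p. ennreal (gagliardo s (\<lambda>x. u x - \<phi> 0 x) p) * indicator (\<Omega> \<times> \<Omega>) p \<partial>lebesgue) +
      (\<integral>\<^sup>+p. ennreal (gagliardo s (\<phi> 0) p) \<partial>lebesgue)"
    by (rule nn_integral_add) measurable
  also have "\<dots> < \<infinity>"
  proof -
    have "(\<integral>\<^sup>+p. ennreal (gagliardo s (\<lambda>x. u x - \<phi> 0 x) p) * indicator (\<Omega> \<times> \<Omega>) p \<partial>lebesgue) < \<infinity>"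
      using fin[of 0] unfolding Ws1_norm_gagliardo by simp
    moreover have "(\<integral>\<^sup>+p. ennreal (gagliardo s (\<phi> 0) p) \<partial>lebesgue) < \<infinity>"
      using test_function_energy_finite[OF \<phi>[of 0] s] unfolding gagliardo_def .
    ultimately show ?thesis by simp
  qed
  finally show ?thesis .
qed

lemma abs_cubic_diff_le:
  fixes a b a' b' :: real
  assumes "\<bar>b\<bar> \<le> 1" "\<bar>a'\<bar> \<le> 1" "\<bar>b'\<bar> \<le> 1"
  shows "\<bar>a * b\<^sup>2 - a' * b'\<^sup>2\<bar> \<le> \<bar>a - a'\<bar> + 2 * \<bar>b - b'\<bar>"
proof -
  have "a * b\<^sup>2 - a' * b'\<^sup>2 = (a - a') * b\<^sup>2 + a' * ((b - b') * (b + b'))"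
    by (simp add: algebra_simps power2_eq_square)
  also have "\<bar>\<dots>\<bar> \<le> \<bar>a - a'\<bar> * b\<^sup>2 + \<bar>a'\<bar> * (\<bar>b - b'\<bar> * \<bar>b + b'\<bar>)"
    by (rule order_trans[OF abs_triangle_ineq]) (simp add: abs_mult)
  also have "\<dots> \<le> \<bar>a - a'\<bar> * 1 + 1 * (\<bar>b - b'\<bar> * 2)"
    using assms by (intro add_mono mult_mono) (auto simp: abs_square_le_1)
  finally show ?thesis by simp
qed

text \<open>The calibration property: the sign field turns increments of every nondecreasing function of \<open>u\<close> into
  their absolute values. If \<open>a = b\<close>, the sign is arbitrary in \<open>{-1..1}\<close>, but the increment vanishes.\<close>

lemma Sgn_mult_mono:
  assumes "t \<in> Sgn (a - b)" and "mono W"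
  shows "t * (W a - W b) = \<bar>W a - W b\<bar>"
proof -
  consider "a > b" | "a = b" | "a < b" by linarith
  then show ?thesis
  proof cases
    case 1
    then show ?thesis using assms monoD[OF assms(2), of b a] by (simp add: Sgn_def)
  next
    case 3
    then show ?thesis using assms monoD[OF assms(2), of a b] by (simp add: Sgn_def)
  qed simp
qed

lemma ennreal_plus_le: "ennreal (a + b) \<le> ennreal a + ennreal b"
  by (cases "a \<ge> 0"; cases "b \<ge> 0") (auto simp: ennreal_neg intro: ennreal_leI)

text \<open>The conditions on \<open>H\<close> keep \<open>H \<circ> \<phi>\<close> in the class of test functions and make \<open>H \<circ> u\<close> inherit both the
  sign of \<open>u\<close> and the sign of its increments, up to zeros.\<close>

locale truncated_weak_solution =
  fixes s :: real and \<Omega> :: "'a::euclidean_space set" and u f :: "'a \<Rightarrow> real"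
    and z :: "'a \<times> 'a \<Rightarrow> real" and H :: "real \<Rightarrow> real" and L :: real
  assumes s: "0 < s" "s < 1"
    and \<Omega>: "open \<Omega>" "bounded \<Omega>"
    and u: "u \<in> Ws1_0 s \<Omega>"
    and f: "set_integrable lebesgue \<Omega> f"
    and z_measurable [measurable]: "z \<in> borel_measurable lebesgue"
    and z_le: "AE p in lebesgue. \<bar>z p\<bar> \<le> 1"
    and z_eq: "\<And>w. w \<in> Ws1_0 s \<Omega> \<Longrightarrow>
        1 / 2 * (LINT p|lebesgue. z p / norm (fst p - snd p) powr (real DIM('a) + s) *
                   (w (fst p) - w (snd p))) = (LINT x:\<Omega>|lebesgue. f x * w x)"
    and z_Sgn: "AE p in lebesgue. p \<in> Q \<Omega> \<longrightarrow> z p \<in> Sgn (u (fst p) - u (snd p))"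
    and H_0: "H 0 = 0" and H_le: "\<And>r. \<bar>H r\<bar> \<le> 1" and H_mono: "mono H"
    and L: "0 \<le> L" and H_Lipschitz: "\<And>r r'. \<bar>H r - H r'\<bar> \<le> L * \<bar>r - r'\<bar>"
    and H_smooth: "\<And>(g :: 'a \<Rightarrow> real) k. (\<And>k. C_k k g) \<Longrightarrow> C_k k (\<lambda>x. H (g x))"
begin

text \<open>The functions with which the equation is tested: the first factor gives the sign of \<open>u\<close>, the second
  one is nonnegative and has compact support if \<open>\<phi>\<close> is a test function. The square makes the limit
  \<open>profile\<close>, the cube of \<open>H (u x)\<close>, a nondecreasing function of \<open>u x\<close>.\<close>

definition competitor :: "('a \<Rightarrow> real) \<Rightarrow> 'a \<Rightarrow> real" where
  "competitor \<phi> x = H (u x) * (H (\<phi> x))\<^sup>2"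

definition profile :: "'a \<Rightarrow> real" where
  "profile x = H (u x) * (H (u x))\<^sup>2"

lemma \<Omega>_measurable [measurable]: "\<Omega> \<in> sets lebesgue" "\<Omega> \<times> \<Omega> \<in> sets lebesgue"
  using \<Omega>(1) by (auto intro: sets_lebesgue_Times)

lemma \<Omega>_finite: "emeasure lebesgue \<Omega> < \<infinity>"
  using \<Omega> emeasure_bounded_finite[of \<Omega>] by simp

lemma H_measurable [measurable]: "H \<in> borel_measurable borel"
  by (rule borel_measurable_mono[OF H_mono])

lemma u_measurable [measurable]: "u \<in> borel_measurable lebesgue"
  and u_eq_0: "AE x in lebesgue. x \<notin> \<Omega> \<longrightarrow> u x = 0"
  using u unfolding Ws1_0_def by auto

lemma competitor_measurable [measurable]: "\<phi> \<in> borel_measurable lebesgue \<Longrightarrow> competitor \<phi> \<in> borel_measurable lebesgue"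
  unfolding competitor_def[abs_def] by measurable

lemma profile_measurable [measurable]: "profile \<in> borel_measurable lebesgue"
  unfolding profile_def[abs_def] by measurable

lemma H_continuous: "isCont H r"
proof -
  have "L-lipschitz_on UNIV H" using H_Lipschitz L by (auto intro!: lipschitz_onI simp: dist_real_def)
  then show ?thesis
    using lipschitz_on_continuous_on continuous_on_eq_continuous_at open_UNIV by blast
qed

lemma H_tendsto: "(g \<longlongrightarrow> l) F \<Longrightarrow> ((\<lambda>j. H (g j)) \<longlongrightarrow> H l) F"
  using isCont_tendsto_compose[OF H_continuous] .

lemma cubic_le_1: "\<bar>H r * (H r')\<^sup>2\<bar> \<le> 1"
  using H_le[of r] H_le[of r'] by (simp add: abs_mult mult_le_one abs_square_le_1)

lemma cubic_Lipschitz: "\<bar>H a * (H b)\<^sup>2 - H a' * (H b')\<^sup>2\<bar> \<le> 2 * L * (\<bar>a - a'\<bar> + \<bar>b - b'\<bar>)"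
proof -
  have "\<bar>H a * (H b)\<^sup>2 - H a' * (H b')\<^sup>2\<bar> \<le> L * \<bar>a - a'\<bar> + 2 * (L * \<bar>b - b'\<bar>)"
    using abs_cubic_diff_le[OF H_le H_le H_le, of "H a" b a' b'] H_Lipschitz[of a a'] H_Lipschitz[of b b']
    by linarith
  also have "\<dots> \<le> 2 * L * (\<bar>a - a'\<bar> + \<bar>b - b'\<bar>)"
    using L by (simp add: algebra_simps)
  finally show ?thesis .
qed

lemma test_energy_finite:
  assumes "\<phi> \<in> test_functions \<Omega>"
  shows "(\<integral>\<^sup>+p. ennreal (gagliardo s \<phi> p) \<partial>lebesgue) < \<infinity>"
    and "(\<integral>\<^sup>+p. ennreal (gagliardo s \<phi> p) * indicator (\<Omega> \<times> \<Omega>) p \<partial>lebesgue) < \<infinity>"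
proof -
  show 1: "(\<integral>\<^sup>+p. ennreal (gagliardo s \<phi> p) \<partial>lebesgue) < \<infinity>"
    using test_function_energy_finite[OF assms s] unfolding gagliardo_def .
  have "(\<integral>\<^sup>+p. ennreal (gagliardo s \<phi> p) * indicator (\<Omega> \<times> \<Omega>) p \<partial>lebesgue) \<le> (\<integral>\<^sup>+p. ennreal (gagliardo s \<phi> p) \<partial>lebesgue)"
    by (intro nn_integral_mono) (auto split: split_indicator)
  then show "(\<integral>\<^sup>+p. ennreal (gagliardo s \<phi> p) * indicator (\<Omega> \<times> \<Omega>) p \<partial>lebesgue) < \<infinity>"
    using 1 by (rule le_less_trans)
qed

lemmas u_energy_finite = Ws1_0_energy_finite[OF u \<Omega>_measurable(1) s]

lemma competitor_eq_0: "\<phi> \<in> test_functions \<Omega> \<Longrightarrow> x \<notin> \<Omega> \<Longrightarrow> competitor \<phi> x = 0"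
  using test_function_eq_0[of \<phi> \<Omega> x] by (simp add: competitor_def H_0)

text \<open>With \<open>\<phi>\<close> fixed and test functions \<open>\<psi> j\<close> tending to \<open>u\<close>, the products \<open>H (\<psi> j x) * (H (\<phi> x))\<^sup>2\<close> are
  test functions and converge to the competitor.\<close>

lemma competitor_in_Ws1_0:
  assumes \<phi>: "\<phi> \<in> test_functions \<Omega>"
  shows "competitor \<phi> \<in> Ws1_0 s \<Omega>"
proof -
  obtain \<psi> where \<psi>: "\<And>j. \<psi> j \<in> test_functions \<Omega>"
    and conv: "(\<lambda>j. Ws1_norm s \<Omega> (\<lambda>x. u x - \<psi> j x)) \<longlonglongrightarrow> 0"
    and lim: "AE x in lebesgue. x \<in> \<Omega> \<longrightarrow> (\<lambda>j. \<psi> j x) \<longlonglongrightarrow> u x"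
    using Ws1_0_approximation[OF u \<Omega>_measurable(1)] by blast
  have [measurable]: "\<phi> \<in> borel_measurable lebesgue" "\<And>j. \<psi> j \<in> borel_measurable lebesgue"
    using \<phi> \<psi> borel_measurable_test_function by blast+
  define F where "F j x = H (\<psi> j x) * (H (\<phi> x))\<^sup>2" for j x
  have F: "F j \<in> test_functions \<Omega>" for j
  proof (rule test_functionsI[OF \<phi>])
    have "C_k k \<phi>" "C_k k (\<psi> j)" for k using \<phi> \<psi> unfolding test_functions_def by blast+
    then show "C_k k (F j)" for k
      unfolding F_def[abs_def] power2_eq_square by (intro C_k_mult H_smooth)
  qed (simp add: F_def H_0)
  have F_conv: "(\<lambda>j. Ws1_norm s \<Omega> (\<lambda>x. competitor \<phi> x - F j x)) \<longlonglongrightarrow> 0"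
  proof (rule Ws1_norm_composition_tendsto[where a'=u and a=\<psi> and b=\<phi> and C="2 * L"])
    show "F j \<in> borel_measurable lebesgue" for j unfolding F_def[abs_def] by measurable
    show "AE x in lebesgue. x \<in> \<Omega> \<longrightarrow> (\<lambda>j. \<psi> j x) \<longlonglongrightarrow> u x \<and> (\<lambda>j. F j x) \<longlonglongrightarrow> competitor \<phi> x"
      using lim by eventually_elim (auto simp: F_def competitor_def intro!: tendsto_mult H_tendsto)
    show "\<bar>F j x\<bar> \<le> 1" for j x unfolding F_def by (rule cubic_le_1)
    show "\<bar>F j x - F j y\<bar> \<le> 2 * L * (\<bar>\<psi> j x - \<psi> j y\<bar> + \<bar>\<phi> x - \<phi> y\<bar>)" for j x y
      unfolding F_def by (rule cubic_Lipschitz)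
  qed (use conv u_energy_finite test_energy_finite[OF \<phi>] \<Omega>_finite L in simp_all)
  have "\<exists>\<psi>\<in>test_functions \<Omega>. Ws1_norm s \<Omega> (\<lambda>x. competitor \<phi> x - \<psi> x) < \<epsilon>" if "\<epsilon> > 0" for \<epsilon>
    using order_tendstoD(2)[OF F_conv that] F unfolding eventually_sequentially by blast
  moreover have "competitor \<phi> \<in> borel_measurable lebesgue" by measurable
  ultimately show ?thesis
    unfolding Ws1_0_def using competitor_eq_0[OF \<phi>] by auto
qed

lemma competitor_tendsto_profile:
  assumes \<phi>: "\<And>j. \<phi> j \<in> test_functions \<Omega>"
    and conv: "(\<lambda>j. Ws1_norm s \<Omega> (\<lambda>x. u x - \<phi> j x)) \<longlonglongrightarrow> 0"
    and lim: "AE x in lebesgue. x \<in> \<Omega> \<longrightarrow> (\<lambda>j. \<phi> j x) \<longlonglongrightarrow> u x"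
  shows "(\<lambda>j. Ws1_norm s \<Omega> (\<lambda>x. profile x - competitor (\<phi> j) x)) \<longlonglongrightarrow> 0"
    and "AE x in lebesgue. x \<in> \<Omega> \<longrightarrow> (\<lambda>j. competitor (\<phi> j) x) \<longlonglongrightarrow> profile x"
proof -
  have [measurable]: "\<And>j. \<phi> j \<in> borel_measurable lebesgue"
    using \<phi> borel_measurable_test_function by blast
  show lim2: "AE x in lebesgue. x \<in> \<Omega> \<longrightarrow> (\<lambda>j. competitor (\<phi> j) x) \<longlonglongrightarrow> profile x"
    using lim by eventually_elim (auto simp: profile_def competitor_def intro!: tendsto_intros H_tendsto)
  show "(\<lambda>j. Ws1_norm s \<Omega> (\<lambda>x. profile x - competitor (\<phi> j) x)) \<longlonglongrightarrow> 0"
  proof (rule Ws1_norm_composition_tendsto[where a'=u and a=\<phi> and b=u and C="2 * L"])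
    show "AE x in lebesgue. x \<in> \<Omega> \<longrightarrow> (\<lambda>j. \<phi> j x) \<longlonglongrightarrow> u x \<and> (\<lambda>j. competitor (\<phi> j) x) \<longlonglongrightarrow> profile x"
      using lim lim2 by eventually_elim auto
    show "\<bar>competitor (\<phi> j) x\<bar> \<le> 1" for j x unfolding competitor_def by (rule cubic_le_1)
    show "\<bar>competitor (\<phi> j) x - competitor (\<phi> j) y\<bar> \<le> 2 * L * (\<bar>\<phi> j x - \<phi> j y\<bar> + \<bar>u x - u y\<bar>)" for j x y
      using cubic_Lipschitz[of "u x" "\<phi> j x" "u y" "\<phi> j y"] by (simp add: competitor_def add.commute)
  qed (use conv u_energy_finite \<Omega>_finite L in simp_all)
qed


definition flux :: "('a \<Rightarrow> real) \<Rightarrow> 'a \<times> 'a \<Rightarrow> real" where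
  "flux \<phi> p = z p / norm (fst p - snd p) powr (real DIM('a) + s) * (competitor \<phi> (fst p) - competitor \<phi> (snd p))"

lemma flux_measurable [measurable]:
  assumes "\<phi> \<in> borel_measurable lebesgue"
  shows "flux \<phi> \<in> borel_measurable lebesgue"
proof -
  note [measurable] = measurable_compose[OF measurable_lebesgue_fst_snd(1) competitor_measurable[OF assms]]
    measurable_compose[OF measurable_lebesgue_fst_snd(2) competitor_measurable[OF assms]]
  show ?thesis unfolding flux_def[abs_def] by measurable
qed

lemma abs_competitor_le: "\<bar>competitor \<phi> x\<bar> \<le> L * \<bar>\<phi> x\<bar>"
proof -
  have "\<bar>competitor \<phi> x\<bar> = \<bar>H (u x)\<bar> * (\<bar>H (\<phi> x)\<bar> * \<bar>H (\<phi> x)\<bar>)"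
    by (simp add: competitor_def abs_mult power2_eq_square)
  also have "\<dots> \<le> 1 * (1 * \<bar>H (\<phi> x)\<bar>)"
    using H_le by (intro mult_mono) auto
  also have "\<dots> \<le> L * \<bar>\<phi> x\<bar>" using H_Lipschitz[of "\<phi> x" 0] H_0 by simp
  finally show ?thesis .
qed

text \<open>If one of the two points lies outside \<open>\<Omega>\<close>, then \<open>\<phi>\<close> and the competitor vanish there, and
  \<open>\<bar>competitor \<phi> x\<bar> \<le> L * \<bar>\<phi> x\<bar>\<close> bounds the quotient by that of \<open>\<phi>\<close> alone. So the energy of \<open>u\<close> enters
  on \<open>\<Omega> \<times> \<Omega>\<close> only, where it is finite.\<close>

lemma gagliardo_competitor_le:
  assumes \<phi>: "\<phi> \<in> test_functions \<Omega>"
  shows "gagliardo s (competitor \<phi>) p \<le> 2 * L * (indicator (\<Omega> \<times> \<Omega>) p * gagliardo s u p + gagliardo s \<phi> p)"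
proof (cases "p \<in> \<Omega> \<times> \<Omega>")
  case True
  then show ?thesis
    using gagliardo_mono[of "competitor \<phi>" p "2 * L" u \<phi> s] cubic_Lipschitz by (simp add: competitor_def)
next
  case False
  then have "fst p \<notin> \<Omega> \<or> snd p \<notin> \<Omega>" by (auto simp: mem_Times_iff)
  then have "\<bar>competitor \<phi> (fst p) - competitor \<phi> (snd p)\<bar> \<le> L * \<bar>\<phi> (fst p) - \<phi> (snd p)\<bar>"
    using competitor_eq_0[OF \<phi>] test_function_eq_0[OF \<phi>] abs_competitor_le[of \<phi> "fst p"] abs_competitor_le[of \<phi> "snd p"] by auto
  moreover have "0 \<le> L * \<bar>\<phi> (fst p) - \<phi> (snd p)\<bar>" using L by simp
  ultimately have "\<bar>competitor \<phi> (fst p) - competitor \<phi> (snd p)\<bar> \<le> 2 * L * (\<bar>0 - 0\<bar> + \<bar>\<phi> (fst p) - \<phi> (snd p)\<bar>)" by simp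
  then have "gagliardo s (competitor \<phi>) p \<le> 2 * L * (gagliardo s (\<lambda>_. 0) p + gagliardo s \<phi> p)"
    by (rule gagliardo_mono)
  then show ?thesis using False by (simp add: gagliardo_def)
qed

lemma gagliardo_competitor_integrable:
  assumes \<phi>: "\<phi> \<in> test_functions \<Omega>"
  shows "integrable lebesgue (gagliardo s (competitor \<phi>))"
proof (rule integrableI_nonneg)
  have [measurable]: "\<phi> \<in> borel_measurable lebesgue" using \<phi> by (rule borel_measurable_test_function)
  show "gagliardo s (competitor \<phi>) \<in> borel_measurable lebesgue" by measurable
  have "(\<integral>\<^sup>+p. ennreal (gagliardo s (competitor \<phi>) p) \<partial>lebesgue) \<le>
      (\<integral>\<^sup>+p. ennreal (2 * L) * (ennreal (gagliardo s u p) * indicator (\<Omega> \<times> \<Omega>) p + ennreal (gagliardo s \<phi> p)) \<partial>lebesgue)"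
  proof (intro nn_integral_mono)
    fix p
    have "ennreal (gagliardo s (competitor \<phi>) p) \<le> ennreal (2 * L * (indicator (\<Omega> \<times> \<Omega>) p * gagliardo s u p + gagliardo s \<phi> p))"
      by (intro ennreal_leI gagliardo_competitor_le[OF \<phi>])
    also have "\<dots> = ennreal (2 * L) * ennreal (indicator (\<Omega> \<times> \<Omega>) p * gagliardo s u p + gagliardo s \<phi> p)"
      using L by (intro ennreal_mult) auto
    also have "\<dots> = ennreal (2 * L) * (ennreal (gagliardo s u p) * indicator (\<Omega> \<times> \<Omega>) p + ennreal (gagliardo s \<phi> p))"
      by (auto split: split_indicator)
    finally show "ennreal (gagliardo s (competitor \<phi>) p) \<le> \<dots>" .
  qed
  also have "\<dots> = ennreal (2 * L) * ((\<integral>\<^sup>+p. ennreal (gagliardo s u p) * indicator (\<Omega> \<times> \<Omega>) p \<partial>lebesgue)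
      + (\<integral>\<^sup>+p. ennreal (gagliardo s \<phi> p) \<partial>lebesgue))"
    by (subst nn_integral_cmult, measurable, subst nn_integral_add, measurable)
  also have "\<dots> < \<infinity>"
    using u_energy_finite test_energy_finite(1)[OF \<phi>] by (simp add: ennreal_mult_less_top)
  finally show "(\<integral>\<^sup>+p. ennreal (gagliardo s (competitor \<phi>) p) \<partial>lebesgue) < \<infinity>" .
qed simp

lemma flux_integrable:
  assumes \<phi>: "\<phi> \<in> test_functions \<Omega>"
  shows "integrable lebesgue (flux \<phi>)"
proof (rule Bochner_Integration.integrable_bound[OF gagliardo_competitor_integrable[OF \<phi>]])
  show "flux \<phi> \<in> borel_measurable lebesgue"
    using flux_measurable borel_measurable_test_function[OF \<phi>] by blast
  show "AE p in lebesgue. norm (flux \<phi> p) \<le> norm (gagliardo s (competitor \<phi>) p)"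
    using z_le
  proof eventually_elim
    case (elim p)
    then show ?case
      using mult_right_mono[OF elim, of "gagliardo s (competitor \<phi>) p"]
      by (simp add: flux_def gagliardo_def abs_mult)
  qed
qed

lemma profile_mono: "mono (\<lambda>r. H r * (H r)\<^sup>2)"
proof (rule monoI)
  fix x y :: real
  assume "x \<le> y"
  then have "(H x) ^ 3 \<le> (H y) ^ 3" using H_mono by (intro power_mono_odd) (auto dest: monoD)
  then show "H x * (H x)\<^sup>2 \<le> H y * (H y)\<^sup>2" by (simp add: power3_eq_cube power2_eq_square mult.assoc)
qed

text \<open>On \<open>\<Omega> \<times> \<Omega>\<close> the field \<open>z\<close> calibrates \<open>profile\<close>, and each of the two exchanges of the competitor with
  the profile costs one quotient of their difference. If exactly one point lies in \<open>\<Omega>\<close>, then \<open>z\<close> is the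
  sign of \<open>u\<close> there, up to orientation, which is also the sign of the competitor wherever the competitor
  does not vanish; so the competitor is calibrated exactly.\<close>

lemma gagliardo_competitor_le_flux:
  assumes \<phi>: "\<phi> \<in> test_functions \<Omega>"
  shows "AE p in lebesgue. gagliardo s (competitor \<phi>) p
    \<le> flux \<phi> p + 2 * (indicator (\<Omega> \<times> \<Omega>) p * gagliardo s (\<lambda>x. profile x - competitor \<phi> x) p)"
proof -
  have u_fst: "AE p in (lebesgue :: ('a \<times> 'a) measure). fst p \<notin> \<Omega> \<longrightarrow> u (fst p) = 0"
    and u_snd: "AE p in (lebesgue :: ('a \<times> 'a) measure). snd p \<notin> \<Omega> \<longrightarrow> u (snd p) = 0"
    by (rule AE_lebesgue_fst_snd[OF u_eq_0])+
  show ?thesis using z_le z_Sgn u_fst u_snd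
  proof eventually_elim
    case (elim p)
    define x y where "x = fst p" and "y = snd p"
    define k where "k = norm (x - y) powr (real DIM('a) + s)"
    have k: "k \<ge> 0" unfolding k_def by simp
    have flux: "flux \<phi> p = z p * (competitor \<phi> x - competitor \<phi> y) / k"
      and gag: "gagliardo s g p = \<bar>g x - g y\<bar> / k" for g
      by (simp_all add: flux_def gagliardo_def x_def y_def k_def)
    have mono: "mono (\<lambda>r. H r * c\<^sup>2)" for c
      by (rule monoI) (simp add: mult_right_mono monoD[OF H_mono])
    consider "x \<in> \<Omega>" "y \<in> \<Omega>" | "x \<in> \<Omega>" "y \<notin> \<Omega>" | "x \<notin> \<Omega>" "y \<in> \<Omega>" | "x \<notin> \<Omega>" "y \<notin> \<Omega>" by blast
    then show ?case
    proof cases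
      case 1
      then have "z p \<in> Sgn (u x - u y)" using elim by (auto simp: Q_def x_def y_def mem_Times_iff)
      from Sgn_mult_mono[OF this profile_mono] have zw: "z p * (profile x - profile y) = \<bar>profile x - profile y\<bar>" by (simp add: profile_def)
      let ?d = "(profile x - competitor \<phi> x) - (profile y - competitor \<phi> y)"
      have "z p * ?d \<le> \<bar>?d\<bar>"
        using mult_right_mono[OF elim(1), of "\<bar>?d\<bar>"] by (simp add: abs_mult[symmetric])
      moreover have "\<bar>competitor \<phi> x - competitor \<phi> y\<bar> \<le> \<bar>profile x - profile y\<bar> + \<bar>?d\<bar>" by linarith
      moreover have "z p * (profile x - profile y) = z p * (competitor \<phi> x - competitor \<phi> y) + z p * ?d" by (simp add: algebra_simps)
      moreover have "V \<le> A + 2 * D" if "B \<le> D" "V \<le> W + D" "C = A + B" "C = W" for V W A B C D :: real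
        using that by linarith
      ultimately have "\<bar>competitor \<phi> x - competitor \<phi> y\<bar> \<le> z p * (competitor \<phi> x - competitor \<phi> y) + 2 * \<bar>?d\<bar>" using zw by blast
      then have "\<bar>competitor \<phi> x - competitor \<phi> y\<bar> / k \<le> (z p * (competitor \<phi> x - competitor \<phi> y) + 2 * \<bar>?d\<bar>) / k"
        using k by (rule divide_right_mono)
      moreover have "p \<in> \<Omega> \<times> \<Omega>" using 1 by (simp add: x_def y_def mem_Times_iff)
      ultimately show ?thesis unfolding flux gag by (simp add: add_divide_distrib)
    next
      case 2
      then have "z p \<in> Sgn (u x - 0)" using elim by (auto simp: Q_def x_def y_def mem_Times_iff)
      from Sgn_mult_mono[OF this mono[of "H (\<phi> x)"]] have "z p * competitor \<phi> x = \<bar>competitor \<phi> x\<bar>"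
        by (simp add: competitor_def H_0)
      then show ?thesis using 2 competitor_eq_0[OF \<phi>, of y] unfolding flux gag
        by (auto simp: x_def y_def mem_Times_iff indicator_def)
    next
      case 3
      then have "z p \<in> Sgn (0 - u y)" using elim by (auto simp: Q_def x_def y_def mem_Times_iff)
      from Sgn_mult_mono[OF this mono[of "H (\<phi> y)"]] have "- (z p * competitor \<phi> y) = \<bar>competitor \<phi> y\<bar>"
        by (simp add: competitor_def H_0)
      then show ?thesis using 3 competitor_eq_0[OF \<phi>, of x] unfolding flux gag
        by (auto simp: x_def y_def mem_Times_iff indicator_def)
    next
      case 4
      then show ?thesis using competitor_eq_0[OF \<phi>, of x] competitor_eq_0[OF \<phi>, of y] unfolding flux gag
        by (auto simp: x_def y_def mem_Times_iff indicator_def)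
    qed
  qed
qed

lemma energy_competitor_le:
  assumes \<phi>: "\<phi> \<in> test_functions \<Omega>"
  shows "(\<integral>\<^sup>+p. ennreal (gagliardo s (competitor \<phi>) p) \<partial>lebesgue)
    \<le> ennreal (2 * (LINT x:\<Omega>|lebesgue. f x * competitor \<phi> x)) + 2 * Ws1_norm s \<Omega> (\<lambda>x. profile x - competitor \<phi> x)"
proof (cases "Ws1_norm s \<Omega> (\<lambda>x. profile x - competitor \<phi> x) = \<infinity>")
  case True
  then show ?thesis by (simp add: ennreal_mult_top)
next
  case False
  have [measurable]: "\<phi> \<in> borel_measurable lebesgue" using \<phi> by (rule borel_measurable_test_function)
  define d where "d p = indicator (\<Omega> \<times> \<Omega>) p * gagliardo s (\<lambda>x. profile x - competitor \<phi> x) p" for p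
  have [measurable]: "d \<in> borel_measurable lebesgue" unfolding d_def by measurable
  have "(\<integral>\<^sup>+p. ennreal (d p) \<partial>lebesgue) =
      (\<integral>\<^sup>+p. ennreal (gagliardo s (\<lambda>x. profile x - competitor \<phi> x) p) * indicator (\<Omega> \<times> \<Omega>) p \<partial>lebesgue)"
    unfolding d_def by (intro nn_integral_cong) (auto split: split_indicator)
  also have "\<dots> \<le> Ws1_norm s \<Omega> (\<lambda>x. profile x - competitor \<phi> x)" unfolding Ws1_norm_gagliardo by simp
  finally have d_le: "(\<integral>\<^sup>+p. ennreal (d p) \<partial>lebesgue) \<le> Ws1_norm s \<Omega> (\<lambda>x. profile x - competitor \<phi> x)" .
  have d0: "d p \<ge> 0" for p unfolding d_def by simp
  have d_int: "integrable lebesgue d"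
    using d_le False by (intro integrableI_nonneg) (auto simp: d0 less_top[symmetric] top_unique)
  have AE: "AE p in lebesgue. gagliardo s (competitor \<phi>) p \<le> flux \<phi> p + 2 * d p"
    using gagliardo_competitor_le_flux[OF \<phi>] unfolding d_def .
  then have AE0: "AE p in lebesgue. 0 \<le> flux \<phi> p + 2 * d p"
    by eventually_elim (use gagliardo_nonneg order_trans in blast)
  have "(\<integral>\<^sup>+p. ennreal (gagliardo s (competitor \<phi>) p) \<partial>lebesgue) \<le> (\<integral>\<^sup>+p. ennreal (flux \<phi> p + 2 * d p) \<partial>lebesgue)"
    using AE by (intro nn_integral_mono_AE) (auto elim!: eventually_mono intro: ennreal_leI)
  also have "\<dots> = ennreal (LINT p|lebesgue. flux \<phi> p + 2 * d p)"
    using flux_integrable[OF \<phi>] d_int AE0 by (intro nn_integral_eq_integral) auto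
  also have "(LINT p|lebesgue. flux \<phi> p + 2 * d p) = (LINT p|lebesgue. flux \<phi> p) + 2 * (LINT p|lebesgue. d p)"
    using flux_integrable[OF \<phi>] d_int by simp
  also have "(LINT p|lebesgue. flux \<phi> p) = 2 * (LINT x:\<Omega>|lebesgue. f x * competitor \<phi> x)"
    using z_eq[OF competitor_in_Ws1_0[OF \<phi>]] unfolding flux_def by simp
  also have "ennreal (2 * (LINT x:\<Omega>|lebesgue. f x * competitor \<phi> x) + 2 * (LINT p|lebesgue. d p))
      \<le> ennreal (2 * (LINT x:\<Omega>|lebesgue. f x * competitor \<phi> x)) + ennreal (2 * (LINT p|lebesgue. d p))"
    by (rule ennreal_plus_le)
  also have "ennreal (2 * (LINT p|lebesgue. d p)) = 2 * (\<integral>\<^sup>+p. ennreal (d p) \<partial>lebesgue)"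
    using d_int d0 by (simp add: nn_integral_eq_integral ennreal_mult)
  also have "\<dots> \<le> 2 * Ws1_norm s \<Omega> (\<lambda>x. profile x - competitor \<phi> x)"
    using d_le by (intro mult_left_mono) auto
  finally show ?thesis by (simp add: add_left_mono)
qed

text \<open>The right-hand sides of \<open>energy_competitor_le\<close> converge because the competitors converge to the
  profile in the norm of \<open>\<Omega>\<close> and boundedly almost everywhere; Fatou's lemma handles the energy on the
  whole space, including the interaction of \<open>\<Omega>\<close> with its complement.\<close>

lemma energy_profile_le:
  "(\<integral>\<^sup>+p. ennreal (gagliardo s (\<lambda>x. indicator \<Omega> x * profile x) p) \<partial>lebesgue)
    \<le> ennreal (2 * (LINT x:\<Omega>|lebesgue. f x * profile x))"
proof -
  obtain \<phi> :: "nat \<Rightarrow> 'a \<Rightarrow> real" where \<phi>: "\<And>j. \<phi> j \<in> test_functions \<Omega>"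
    and conv: "(\<lambda>j. Ws1_norm s \<Omega> (\<lambda>x. u x - \<phi> j x)) \<longlonglongrightarrow> 0"
    and lim: "AE x in lebesgue. x \<in> \<Omega> \<longrightarrow> (\<lambda>j. \<phi> j x) \<longlonglongrightarrow> u x"
    using Ws1_0_approximation[OF u \<Omega>_measurable(1)] by blast
  have [measurable]: "\<And>j. \<phi> j \<in> borel_measurable lebesgue"
    using \<phi> borel_measurable_test_function by blast
  note vw = competitor_tendsto_profile[OF \<phi> conv lim]
  let ?W = "\<lambda>x. indicator \<Omega> x * profile x"
  have lim_v: "AE x in lebesgue. (\<lambda>j. competitor (\<phi> j) x) \<longlonglongrightarrow> ?W x"
    using vw(2)
  proof eventually_elim
    case (elim x)
    then show ?case using competitor_eq_0[OF \<phi>, of x] by (cases "x \<in> \<Omega>") auto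
  qed
  have f_int: "integrable lebesgue (\<lambda>x. indicator \<Omega> x *\<^sub>R f x)"
    using f unfolding set_integrable_def .
  have lim_f: "(\<lambda>j. LINT x:\<Omega>|lebesgue. f x * competitor (\<phi> j) x) \<longlonglongrightarrow> (LINT x:\<Omega>|lebesgue. f x * profile x)"
    unfolding set_lebesgue_integral_def
  proof (rule integral_dominated_convergence[where w="\<lambda>x. \<bar>indicator \<Omega> x *\<^sub>R f x\<bar>"])
    have [measurable]: "(\<lambda>x. indicator \<Omega> x * f x) \<in> borel_measurable lebesgue"
      using f_int by (auto dest: borel_measurable_integrable)
    have "(\<lambda>x. (indicator \<Omega> x * f x) * profile x) \<in> borel_measurable lebesgue" by measurable
    then show "(\<lambda>x. indicator \<Omega> x *\<^sub>R (f x * profile x)) \<in> borel_measurable lebesgue" by (simp add: mult.assoc)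
    have "(\<lambda>x. (indicator \<Omega> x * f x) * competitor (\<phi> j) x) \<in> borel_measurable lebesgue" for j by measurable
    then show "(\<lambda>x. indicator \<Omega> x *\<^sub>R (f x * competitor (\<phi> j) x)) \<in> borel_measurable lebesgue" for j by (simp add: mult.assoc)
    show "integrable lebesgue (\<lambda>x. \<bar>indicator \<Omega> x *\<^sub>R f x\<bar>)" using f_int by (rule integrable_abs)
    show "AE x in lebesgue. (\<lambda>j. indicator \<Omega> x *\<^sub>R (f x * competitor (\<phi> j) x)) \<longlonglongrightarrow> indicator \<Omega> x *\<^sub>R (f x * profile x)"
      using vw(2) by eventually_elim (auto intro!: tendsto_intros split: split_indicator)
    show "AE x in lebesgue. norm (indicator \<Omega> x *\<^sub>R (f x * competitor (\<phi> j) x)) \<le> \<bar>indicator \<Omega> x *\<^sub>R f x\<bar>" for j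
    proof (rule AE_I2)
      fix x
      have "\<bar>competitor (\<phi> j) x\<bar> \<le> 1" unfolding competitor_def by (rule cubic_le_1)
      then show "norm (indicator \<Omega> x *\<^sub>R (f x * competitor (\<phi> j) x)) \<le> \<bar>indicator \<Omega> x *\<^sub>R f x\<bar>"
        by (auto simp: abs_mult mult_left_le split: split_indicator)
    qed
  qed
  have "(\<lambda>j. ennreal (2 * (LINT x:\<Omega>|lebesgue. f x * competitor (\<phi> j) x)) + 2 * Ws1_norm s \<Omega> (\<lambda>x. profile x - competitor (\<phi> j) x))
     \<longlonglongrightarrow> ennreal (2 * (LINT x:\<Omega>|lebesgue. f x * profile x)) + 2 * 0"
    by (intro tendsto_add tendsto_ennrealI tendsto_mult_ennreal tendsto_mult tendsto_const lim_f vw(1)) auto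
  then have rhs: "liminf (\<lambda>j. ennreal (2 * (LINT x:\<Omega>|lebesgue. f x * competitor (\<phi> j) x)) + 2 * Ws1_norm s \<Omega> (\<lambda>x. profile x - competitor (\<phi> j) x))
     = ennreal (2 * (LINT x:\<Omega>|lebesgue. f x * profile x))"
    by (intro lim_imp_Liminf) auto
  have "AE p in lebesgue. liminf (\<lambda>j. ennreal (gagliardo s (competitor (\<phi> j)) p)) = ennreal (gagliardo s ?W p)"
    using AE_lebesgue_fst_snd(1)[OF lim_v] AE_lebesgue_fst_snd(2)[OF lim_v]
  proof eventually_elim
    case (elim p)
    then have "(\<lambda>j. ennreal (\<bar>competitor (\<phi> j) (fst p) - competitor (\<phi> j) (snd p)\<bar> * inverse (norm (fst p - snd p) powr (real DIM('a) + s))))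
      \<longlonglongrightarrow> ennreal (\<bar>?W (fst p) - ?W (snd p)\<bar> * inverse (norm (fst p - snd p) powr (real DIM('a) + s)))"
      by (intro tendsto_ennrealI tendsto_intros)
    then show ?case unfolding gagliardo_def divide_inverse by (intro lim_imp_Liminf) auto
  qed
  then have "(\<integral>\<^sup>+p. ennreal (gagliardo s ?W p) \<partial>lebesgue) =
      (\<integral>\<^sup>+p. liminf (\<lambda>j. ennreal (gagliardo s (competitor (\<phi> j)) p)) \<partial>lebesgue)"
    by (intro nn_integral_cong_AE) (auto elim!: eventually_mono)
  also have "\<dots> \<le> liminf (\<lambda>j. \<integral>\<^sup>+p. ennreal (gagliardo s (competitor (\<phi> j)) p) \<partial>lebesgue)"
    by (rule nn_integral_liminf) measurable
  also have "\<dots> \<le> liminf (\<lambda>j. ennreal (2 * (LINT x:\<Omega>|lebesgue. f x * competitor (\<phi> j) x)) + 2 * Ws1_norm s \<Omega> (\<lambda>x. profile x - competitor (\<phi> j) x))"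
    by (intro Liminf_mono always_eventually allI energy_competitor_le \<phi>)
  finally show ?thesis unfolding rhs .
qed
end

section \<open>The energy of superlevel sets\<close>

lemma tanh_Lipschitz: "\<bar>tanh a - tanh b\<bar> \<le> \<bar>a - b\<bar>" for a b :: real
proof -
  have "norm (tanh a - tanh b) \<le> 1 * norm (a - b)"
  proof (rule field_differentiable_bound[of UNIV])
    show "(tanh has_field_derivative 1 - (tanh r)\<^sup>2) (at r within UNIV)" for r :: real
      using has_field_derivative_tanh[of "\<lambda>x. x" r, OF _ DERIV_ident] by simp
    show "norm (1 - (tanh r)\<^sup>2) \<le> 1" for r :: real
    proof -
      have "(tanh r)\<^sup>2 \<le> 1" using tanh_real_bounds[of r] by (simp add: abs_square_le_1 abs_le_iff)
      then show ?thesis by simp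
    qed
  qed auto
  then show ?thesis by simp
qed

text \<open>For \<open>t > 0\<close>, as \<open>m\<close> tends to infinity, this tends to \<open>\<sigma>\<close> where \<open>t < \<sigma> * r\<close> and to \<open>0\<close> where \<open>\<sigma> * r < t\<close>. The sign
  \<open>\<sigma> \<in> {1, -1}\<close> selects superlevel or sublevel sets; the summand \<open>tanh (m * t)\<close> makes the value at
  \<open>0\<close> vanish.\<close>

definition smooth_step :: "real \<Rightarrow> real \<Rightarrow> real \<Rightarrow> real \<Rightarrow> real" where
  "smooth_step \<sigma> t m r = \<sigma> / 2 * (tanh (m * \<sigma> * r + - (m * t)) + tanh (m * t))"

lemma smooth_step_0: "smooth_step \<sigma> t m 0 = 0"
  by (simp add: smooth_step_def)

lemma abs_smooth_step_le: "\<bar>\<sigma>\<bar> = 1 \<Longrightarrow> \<bar>smooth_step \<sigma> t m r\<bar> \<le> 1"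
  using tanh_real_bounds[of "m * \<sigma> * r + - (m * t)"] tanh_real_bounds[of "m * t"]
  by (auto simp: smooth_step_def abs_mult)

lemma mono_smooth_step:
  assumes "\<bar>\<sigma>\<bar> = 1" "0 \<le> m"
  shows "mono (smooth_step \<sigma> t m)"
proof (rule monoI)
  fix x y :: real
  assume "x \<le> y"
  then have xy: "m * x \<le> m * y" using assms by (simp add: mult_left_mono)
  consider "\<sigma> = 1" | "\<sigma> = -1" using assms by (auto simp: abs_if split: if_splits)
  then show "smooth_step \<sigma> t m x \<le> smooth_step \<sigma> t m y"
    by cases (use xy in \<open>simp_all add: smooth_step_def del: tanh_minus\<close>)
qed

lemma smooth_step_Lipschitz:
  assumes "\<bar>\<sigma>\<bar> = 1" "0 \<le> m"
  shows "\<bar>smooth_step \<sigma> t m x - smooth_step \<sigma> t m y\<bar> \<le> m * \<bar>x - y\<bar>"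
proof -
  have "smooth_step \<sigma> t m x - smooth_step \<sigma> t m y = \<sigma> / 2 * (tanh (m * \<sigma> * x + - (m * t)) - tanh (m * \<sigma> * y + - (m * t)))"
    by (simp add: smooth_step_def algebra_simps)
  also have "\<bar>\<dots>\<bar> = 1 / 2 * \<bar>tanh (m * \<sigma> * x + - (m * t)) - tanh (m * \<sigma> * y + - (m * t))\<bar>"
    using assms by (simp add: abs_mult)
  also have "\<dots> \<le> 1 / 2 * \<bar>m * \<sigma> * x - m * \<sigma> * y\<bar>"
    using tanh_Lipschitz[of "m * \<sigma> * x + - (m * t)" "m * \<sigma> * y + - (m * t)"] by simp
  also have "m * \<sigma> * x - m * \<sigma> * y = m * \<sigma> * (x - y)" by (simp add: algebra_simps)
  also have "\<bar>m * \<sigma> * (x - y)\<bar> = m * \<bar>x - y\<bar>" using assms by (simp add: abs_mult)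
  also have "1 / 2 * (m * \<bar>x - y\<bar>) \<le> m * \<bar>x - y\<bar>" using assms by simp
  finally show ?thesis .
qed

lemma C_k_smooth_step:
  assumes "\<And>k. C_k k g"
  shows "C_k k (\<lambda>x. smooth_step \<sigma> t m (g x))"
  unfolding smooth_step_def by (intro C_k_mult C_k_add C_k_const C_k_tanh assms)

lemma tanh_nat_tendsto: "0 < c \<Longrightarrow> (\<lambda>k. tanh (real k * c)) \<longlonglongrightarrow> 1"
  by (rule filterlim_compose[OF tanh_real_at_top])
     (simp add: filterlim_at_top_mult_tendsto_pos[OF tendsto_const _ filterlim_real_sequentially])

lemma smooth_step_tendsto:
  assumes "0 < t" "\<sigma> * r \<noteq> t"
  shows "(\<lambda>k. smooth_step \<sigma> t (real k) r) \<longlonglongrightarrow> (if t < \<sigma> * r then \<sigma> else 0)"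
proof -
  have eq: "smooth_step \<sigma> t (real k) r = \<sigma> / 2 * (tanh (real k * (\<sigma> * r - t)) + tanh (real k * t))" for k
    by (simp add: smooth_step_def algebra_simps)
  show ?thesis
  proof (cases "t < \<sigma> * r")
    case True
    then have "(\<lambda>k. smooth_step \<sigma> t (real k) r) \<longlonglongrightarrow> \<sigma> / 2 * (1 + 1)"
      unfolding eq using assms by (intro tendsto_intros tanh_nat_tendsto) auto
    then show ?thesis using True by simp
  next
    case False
    then have "0 < t - \<sigma> * r" using assms by simp
    moreover have "tanh (real k * (\<sigma> * r - t)) = - tanh (real k * (t - \<sigma> * r))" for k
      by (simp flip: tanh_minus add: algebra_simps)
    ultimately have "(\<lambda>k. smooth_step \<sigma> t (real k) r) \<longlonglongrightarrow> \<sigma> / 2 * (- 1 + 1)"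
      unfolding eq using assms by (simp only:) (intro tendsto_intros tanh_nat_tendsto)
    then show ?thesis using False by simp
  qed
qed

text \<open>The profiles for the truncations \<open>smooth_step \<sigma> t k\<close> are bounded by \<open>1\<close> and tend almost everywhere to
  \<open>\<sigma>\<close> times the indicator of the superlevel set, because the level \<open>t\<close> is attained on a null set only.\<close>

lemma superlevel_set_energy_le:
  fixes \<Omega> :: "'a::euclidean_space set"
  assumes s: "0 < s" "s < 1" and \<Omega>: "open \<Omega>" "bounded \<Omega>" and sol: "weak_solution s \<Omega> f u"
    and f: "set_integrable lebesgue \<Omega> f" and \<sigma>: "\<bar>\<sigma>\<bar> = 1" and t: "0 < t"
    and null: "AE x in lebesgue. x \<in> \<Omega> \<longrightarrow> \<sigma> * u x \<noteq> t"
  shows "(\<integral>\<^sup>+p. ennreal (gagliardo s (indicator {x \<in> \<Omega>. t < \<sigma> * u x}) p) \<partial>lebesgue)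
    \<le> ennreal (2 * (LINT x|lebesgue. indicator {x \<in> \<Omega>. t < \<sigma> * u x} x * (\<sigma> * f x)))"
proof -
  let ?E = "{x \<in> \<Omega>. t < \<sigma> * u x}"
  obtain z where z [measurable]: "z \<in> borel_measurable lebesgue" and z_le: "AE p in lebesgue. \<bar>z p\<bar> \<le> 1"
    and z_eq: "\<And>w. w \<in> Ws1_0 s \<Omega> \<Longrightarrow>
        1 / 2 * (LINT p|lebesgue. z p / norm (fst p - snd p) powr (real DIM('a) + s) *
                   (w (fst p) - w (snd p))) = (LINT x:\<Omega>|lebesgue. f x * w x)"
    and z_Sgn: "AE p in lebesgue. p \<in> Q \<Omega> \<longrightarrow> z p \<in> Sgn (u (fst p) - u (snd p))"
    and u: "u \<in> Ws1_0 s \<Omega>"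
    using sol unfolding weak_solution_def by blast
  have loc: "truncated_weak_solution s \<Omega> u f z (smooth_step \<sigma> t (real k)) (real k)" for k
  proof (rule truncated_weak_solution.intro)
    show "C_k j (\<lambda>x. smooth_step \<sigma> t (real k) (g x))" if "\<And>j. C_k j g" for g :: "'a \<Rightarrow> real" and j
      using that by (rule C_k_smooth_step)
  qed (rule s \<Omega> u f z z_le z_eq z_Sgn smooth_step_0 abs_smooth_step_le[OF \<sigma>] mono_smooth_step[OF \<sigma>]
          smooth_step_Lipschitz[OF \<sigma>] of_nat_0_le_iff | assumption)+
  have [measurable]: "\<Omega> \<in> sets lebesgue" "u \<in> borel_measurable lebesgue"
    using \<Omega> u unfolding Ws1_0_def by auto
  define W where "W k x = indicator \<Omega> x * (smooth_step \<sigma> t (real k) (u x) * (smooth_step \<sigma> t (real k) (u x))\<^sup>2)" for k x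
  have [measurable]: "smooth_step \<sigma> t (real k) \<in> borel_measurable borel" for k
    by (rule borel_measurable_mono[OF mono_smooth_step[OF \<sigma>]]) simp
  have [measurable]: "W k \<in> borel_measurable lebesgue" for k unfolding W_def[abs_def] by measurable
  have lim_W: "AE x in lebesgue. (\<lambda>k. W k x) \<longlonglongrightarrow> \<sigma> * indicator ?E x"
    using null
  proof eventually_elim
    case (elim x)
    have "\<sigma> * \<sigma> = 1" using \<sigma> by (auto simp: abs_if split: if_splits)
    show ?case
    proof (cases "x \<in> \<Omega>")
      case True
      let ?l = "if t < \<sigma> * u x then \<sigma> else 0"
      have "(\<lambda>k. 1 * (smooth_step \<sigma> t (real k) (u x) * (smooth_step \<sigma> t (real k) (u x))\<^sup>2)) \<longlonglongrightarrow> 1 * (?l * ?l\<^sup>2)"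
        using True elim t by (intro tendsto_intros smooth_step_tendsto) auto
      then show ?thesis using True \<open>\<sigma> * \<sigma> = 1\<close> by (auto simp: W_def indicator_def power2_eq_square)
    qed (simp add: W_def)
  qed
  have W_le: "(\<integral>\<^sup>+p. ennreal (gagliardo s (W k) p) \<partial>lebesgue) \<le> ennreal (2 * (LINT x:\<Omega>|lebesgue. f x * W k x))" for k
  proof -
    have "(LINT x:\<Omega>|lebesgue. f x * W k x) = (LINT x:\<Omega>|lebesgue. f x * (smooth_step \<sigma> t (real k) (u x) * (smooth_step \<sigma> t (real k) (u x))\<^sup>2))"
      unfolding set_lebesgue_integral_def by (intro Bochner_Integration.integral_cong) (auto simp: W_def split: split_indicator)
    then show ?thesis
      using truncated_weak_solution.energy_profile_le[OF loc[of k]]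
      unfolding truncated_weak_solution.profile_def[OF loc[of k]] W_def[abs_def] by simp
  qed
  have f_int: "integrable lebesgue (\<lambda>x. indicator \<Omega> x * f x)"
    using f unfolding set_integrable_def by simp
  have lim_f: "(\<lambda>k. LINT x:\<Omega>|lebesgue. f x * W k x) \<longlonglongrightarrow> (LINT x|lebesgue. indicator ?E x * (\<sigma> * f x))"
    unfolding set_lebesgue_integral_def
  proof (rule integral_dominated_convergence[where w="\<lambda>x. \<bar>indicator \<Omega> x * f x\<bar>"])
    have [measurable]: "(\<lambda>x. indicator \<Omega> x * f x) \<in> borel_measurable lebesgue"
      using f_int by (rule borel_measurable_integrable)
    have "(\<lambda>x. (indicator \<Omega> x * f x) * W k x) \<in> borel_measurable lebesgue" for k by measurable
    then show "(\<lambda>x. indicator \<Omega> x *\<^sub>R (f x * W k x)) \<in> borel_measurable lebesgue" for k by (simp add: mult.assoc)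
    have "(\<lambda>x. (indicator \<Omega> x * f x) * (\<sigma> * indicator ?E x)) \<in> borel_measurable lebesgue" by measurable
    moreover have "(indicator \<Omega> x * f x) * (\<sigma> * indicator ?E x) = indicator ?E x * (\<sigma> * f x)" for x
      by (auto split: split_indicator)
    ultimately show "(\<lambda>x. indicator ?E x * (\<sigma> * f x)) \<in> borel_measurable lebesgue" by simp
    show "integrable lebesgue (\<lambda>x. \<bar>indicator \<Omega> x * f x\<bar>)" using f_int by (rule integrable_abs)
    show "AE x in lebesgue. (\<lambda>k. indicator \<Omega> x *\<^sub>R (f x * W k x)) \<longlonglongrightarrow> indicator ?E x * (\<sigma> * f x)"
      using lim_W
    proof eventually_elim
      case (elim x)
      have "(\<lambda>k. indicator \<Omega> x *\<^sub>R (f x * W k x)) \<longlonglongrightarrow> indicator \<Omega> x *\<^sub>R (f x * (\<sigma> * indicator ?E x))"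
        by (intro tendsto_intros elim)
      moreover have "indicator \<Omega> x *\<^sub>R (f x * (\<sigma> * indicator ?E x)) = indicator ?E x * (\<sigma> * f x)"
        by (auto split: split_indicator)
      ultimately show ?case by (simp only:)
    qed
    show "AE x in lebesgue. norm (indicator \<Omega> x *\<^sub>R (f x * W k x)) \<le> \<bar>indicator \<Omega> x * f x\<bar>" for k
    proof (rule AE_I2)
      fix x
      have "\<bar>W k x\<bar> \<le> 1"
        using truncated_weak_solution.cubic_le_1[OF loc[of k]] by (auto simp: W_def abs_mult split: split_indicator)
      then show "norm (indicator \<Omega> x *\<^sub>R (f x * W k x)) \<le> \<bar>indicator \<Omega> x * f x\<bar>"
        by (auto simp: abs_mult mult_left_le split: split_indicator)
    qed
  qed
  have "(\<lambda>k. ennreal (2 * (LINT x:\<Omega>|lebesgue. f x * W k x))) \<longlonglongrightarrow> ennreal (2 * (LINT x|lebesgue. indicator ?E x * (\<sigma> * f x)))"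
    by (intro tendsto_ennrealI tendsto_intros lim_f)
  then have rhs: "liminf (\<lambda>k. ennreal (2 * (LINT x:\<Omega>|lebesgue. f x * W k x))) = ennreal (2 * (LINT x|lebesgue. indicator ?E x * (\<sigma> * f x)))"
    by (intro lim_imp_Liminf) auto
  have "AE p in lebesgue. liminf (\<lambda>k. ennreal (gagliardo s (W k) p)) = ennreal (gagliardo s (indicator ?E) p)"
    using AE_lebesgue_fst_snd(1)[OF lim_W] AE_lebesgue_fst_snd(2)[OF lim_W]
  proof eventually_elim
    case (elim p)
    let ?k = "inverse (norm (fst p - snd p) powr (real DIM('a) + s))"
    have "(\<lambda>k. ennreal (\<bar>W k (fst p) - W k (snd p)\<bar> * ?k))
      \<longlonglongrightarrow> ennreal (\<bar>\<sigma> * indicator ?E (fst p) - \<sigma> * indicator ?E (snd p)\<bar> * ?k)"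
      by (intro tendsto_ennrealI tendsto_intros elim)
    moreover have "\<bar>\<sigma> * indicator ?E (fst p) - \<sigma> * indicator ?E (snd p)\<bar> = \<bar>indicator ?E (fst p) - indicator ?E (snd p) :: real\<bar>"
      using \<sigma> by (simp add: abs_mult flip: right_diff_distrib)
    ultimately show ?case unfolding gagliardo_def divide_inverse by (intro lim_imp_Liminf) auto
  qed
  then have "(\<integral>\<^sup>+p. ennreal (gagliardo s (indicator ?E) p) \<partial>lebesgue) =
      (\<integral>\<^sup>+p. liminf (\<lambda>k. ennreal (gagliardo s (W k) p)) \<partial>lebesgue)"
    by (intro nn_integral_cong_AE) (auto elim!: eventually_mono)
  also have "\<dots> \<le> liminf (\<lambda>k. \<integral>\<^sup>+p. ennreal (gagliardo s (W k) p) \<partial>lebesgue)"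
    by (rule nn_integral_liminf) measurable
  also have "\<dots> \<le> liminf (\<lambda>k. ennreal (2 * (LINT x:\<Omega>|lebesgue. f x * W k x)))"
    by (intro Liminf_mono always_eventually allI W_le)
  finally show ?thesis unfolding rhs .
qed


section \<open>A fractional isoperimetric inequality\<close>

text \<open>Around each point \<open>x\<close> of \<open>E\<close> the ball whose volume is twice that of \<open>E\<close> contains at least the measure of
  \<open>E\<close> of points outside \<open>E\<close>, all at distance less than \<open>r\<close> from \<open>x\<close>. Since \<open>r\<close> is proportional to the
  \<open>n\<close>-th root of the measure of \<open>E\<close>, this is the fractional isoperimetric inequality.\<close>

lemma gagliardo_indicator_ge_borel:
  fixes E :: "'a::euclidean_space set"
  assumes [measurable]: "E \<in> sets borel" and fin: "emeasure lborel E < \<infinity>" and r: "0 < r" and s: "0 < s"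
    and vol: "unit_ball_vol (real DIM('a)) * r ^ DIM('a) = 2 * measure lborel E"
  shows "ennreal ((measure lborel E)\<^sup>2 * r powr (- (real DIM('a) + s)))
    \<le> (\<integral>\<^sup>+p. ennreal (gagliardo s (indicator E) p) \<partial>lborel)"
proof -
  let ?A = "measure lborel E" and ?c = "r powr (- (real DIM('a) + s))"
  have A: "emeasure lborel E = ennreal ?A" using fin by (intro emeasure_eq_ennreal_measure) auto
  have meas: "(\<lambda>p. ennreal (gagliardo s (indicator E) p)) \<in> borel_measurable borel"
  proof -
    have "(\<lambda>p. ennreal (gagliardo s (indicator E) p)) \<in> borel_measurable (borel \<Otimes>\<^sub>M borel)"
      unfolding gagliardo_def by measurable
    then show ?thesis by (simp add: borel_prod)
  qed
  have inner: "ennreal (?A * ?c) \<le> (\<integral>\<^sup>+y. ennreal (gagliardo s (indicator E) (x, y)) \<partial>lborel)" if "x \<in> E" for x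
  proof -
    have "ennreal (2 * ?A) = emeasure lborel (ball x r)"
      using r vol by (simp add: emeasure_ball)
    also have "\<dots> \<le> emeasure lborel ((ball x r - E) \<union> E)" by (intro emeasure_mono) auto
    also have "\<dots> \<le> emeasure lborel (ball x r - E) + emeasure lborel E" by (intro emeasure_subadditive) auto
    finally have "ennreal ?A + ennreal ?A \<le> emeasure lborel (ball x r - E) + ennreal ?A"
      unfolding A by (simp flip: ennreal_plus)
    then have ge: "ennreal ?A \<le> emeasure lborel (ball x r - E)"
      by (simp add: ennreal_add_left_cancel_le add.commute)
    have "ennreal (?A * ?c) = ennreal ?c * ennreal ?A" by (simp add: ennreal_mult mult.commute)
    also have "\<dots> \<le> ennreal ?c * emeasure lborel (ball x r - E)" using ge by (intro mult_left_mono) auto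
    also have "\<dots> = (\<integral>\<^sup>+y. ennreal ?c * indicator (ball x r - E) y \<partial>lborel)"
      by (simp add: nn_integral_cmult_indicator)
    also have "\<dots> \<le> (\<integral>\<^sup>+y. ennreal (gagliardo s (indicator E) (x, y)) \<partial>lborel)"
    proof (intro nn_integral_mono)
      fix y
      show "ennreal ?c * indicator (ball x r - E) y \<le> ennreal (gagliardo s (indicator E) (x, y))"
      proof (cases "y \<in> ball x r - E")
        case True
        then have "0 < norm (x - y)" "norm (x - y) \<le> r" using that by (auto simp: dist_norm)
        then have "?c \<le> norm (x - y) powr (- (real DIM('a) + s))" using s by (intro powr_mono2') auto
        also have "\<dots> = 1 / norm (x - y) powr (real DIM('a) + s)" by (rule powr_minus_divide)
        also have "\<dots> = gagliardo s (indicator E) (x, y)" using True that by (simp add: gagliardo_def)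
        finally show ?thesis using True by (simp add: ennreal_leI)
      qed simp
    qed
    finally show ?thesis .
  qed
  have "ennreal (?A\<^sup>2 * ?c) = ennreal (?A * ?c) * emeasure lborel E"
    unfolding A by (simp add: ennreal_mult[symmetric] power2_eq_square mult_ac)
  also have "\<dots> = (\<integral>\<^sup>+x. ennreal (?A * ?c) * indicator E x \<partial>lborel)" by (simp add: nn_integral_cmult_indicator)
  also have "\<dots> \<le> (\<integral>\<^sup>+x. \<integral>\<^sup>+y. ennreal (gagliardo s (indicator E) (x, y)) \<partial>lborel \<partial>lborel)"
    by (intro nn_integral_mono) (use inner in \<open>auto split: split_indicator\<close>)
  also have "\<dots> = (\<integral>\<^sup>+p. ennreal (gagliardo s (indicator E) p) \<partial>lborel)"
    by (rule nn_integral_lborel_product(1)[OF meas, symmetric])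
  finally show ?thesis .
qed

lemma gagliardo_indicator_ge:
  fixes E :: "'a::euclidean_space set"
  assumes E: "E \<in> sets lebesgue" and fin: "emeasure lebesgue E < \<infinity>" and r: "0 < r" and s: "0 < s"
    and vol: "unit_ball_vol (real DIM('a)) * r ^ DIM('a) = 2 * measure lebesgue E"
  shows "ennreal ((measure lebesgue E)\<^sup>2 * r powr (- (real DIM('a) + s)))
    \<le> (\<integral>\<^sup>+p. ennreal (gagliardo s (indicator E) p) \<partial>lebesgue)"
proof -
  obtain S N N' where SN: "E = S \<union> N" "N \<subseteq> N'" "N' \<in> null_sets lborel" "S \<in> sets lborel"
    using sets_completionE[OF E] by metis
  have S [measurable]: "S \<in> sets borel" using SN by simp
  have "AE x in lebesgue. x \<notin> N'" using SN(3) by (intro AE_completion AE_not_in)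
  then have AE: "AE x in lebesgue. indicator E x = (indicator S x :: real)"
    by eventually_elim (use SN in \<open>auto simp: indicator_def\<close>)
  then have "AE x in lebesgue. x \<in> E \<longleftrightarrow> x \<in> S"
    by eventually_elim (auto simp: indicator_def split: if_splits)
  then have em: "emeasure lebesgue E = emeasure lebesgue S"
    using E S by (intro emeasure_eq_AE) auto
  then have m: "measure lebesgue E = measure lborel S" unfolding measure_def using S by simp
  have "ennreal ((measure lborel S)\<^sup>2 * r powr (- (real DIM('a) + s)))
    \<le> (\<integral>\<^sup>+p. ennreal (gagliardo s (indicator S) p) \<partial>lborel)"
    using fin em vol m S by (intro gagliardo_indicator_ge_borel r s) auto
  also have "\<dots> = (\<integral>\<^sup>+p. ennreal (gagliardo s (indicator S) p) \<partial>lebesgue)" by (simp add: nn_integral_completion)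
  also have "\<dots> = (\<integral>\<^sup>+p. ennreal (gagliardo s (indicator E) p) \<partial>lebesgue)"
  proof (rule nn_integral_cong_AE)
    show "AE p in lebesgue. ennreal (gagliardo s (indicator S) p) = ennreal (gagliardo s (indicator E) p)"
      using AE_lebesgue_fst_snd(1)[OF AE] AE_lebesgue_fst_snd(2)[OF AE]
      by eventually_elim (simp add: gagliardo_def)
  qed
  finally show ?thesis unfolding m .
qed

section \<open>A level set of positive measure\<close>

text \<open>A pointwise form of the Hoelder inequality against an indicator; it is optimised below through the
  choice of \<open>c\<close>.\<close>

lemma abs_le_powr_split:
  fixes a c p :: real
  assumes "0 < c" "1 \<le> p"
  shows "\<bar>a\<bar> \<le> c + c powr (1 - p) * \<bar>a\<bar> powr p"
proof (cases "\<bar>a\<bar> \<le> c")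
  case True
  moreover have "0 \<le> c powr (1 - p) * \<bar>a\<bar> powr p" by simp
  ultimately show ?thesis by linarith
next
  case False
  then have "0 < \<bar>a\<bar>" using assms by linarith
  then have "\<bar>a\<bar> = \<bar>a\<bar> powr (1 - p) * \<bar>a\<bar> powr p" by (simp flip: powr_add)
  also have "\<dots> \<le> c powr (1 - p) * \<bar>a\<bar> powr p"
    using False assms by (intro mult_right_mono powr_mono2') auto
  finally show ?thesis using assms by linarith
qed

lemma L_space_integrable:
  assumes \<Omega>: "\<Omega> \<in> sets lebesgue" "emeasure lebesgue \<Omega> < \<infinity>" and p: "1 \<le> p" and f: "f \<in> L_space p \<Omega>"
  shows "set_integrable lebesgue \<Omega> f"
proof -
  have fp: "integrable lebesgue (\<lambda>x. indicator \<Omega> x * \<bar>f x\<bar> powr p)"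
    and fm: "(\<lambda>x. indicator \<Omega> x * f x) \<in> borel_measurable lebesgue"
    using f by (simp_all add: L_space_def set_integrable_def set_borel_measurable_def)
  have "integrable lebesgue (\<lambda>x. indicator \<Omega> x + indicator \<Omega> x * \<bar>f x\<bar> powr p)"
    using \<Omega> by (intro Bochner_Integration.integrable_add fp integrable_real_indicator)
  then have "integrable lebesgue (\<lambda>x. indicator \<Omega> x * f x)"
  proof (rule Bochner_Integration.integrable_bound[OF _ fm])
    show "AE x in lebesgue. norm (indicator \<Omega> x * f x) \<le> norm (indicator \<Omega> x + indicator \<Omega> x * \<bar>f x\<bar> powr p)"
      using abs_le_powr_split[OF zero_less_one p] by (auto split: split_indicator)
  qed
  then show ?thesis by (simp add: set_integrable_def)
qed

text \<open>The isoperimetric inequality bounds the energy of \<open>E\<close> from below, and the equation bounds it from above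
  by the integral of \<open>\<bar>f\<bar>\<close> over \<open>E\<close>. The exponent \<open>n/s\<close> is the one for which both sides scale in the
  same way in the radius \<open>r\<close>, so a bound independent of the measure of \<open>E\<close> remains.\<close>

lemma superlevel_set_mass:
  fixes \<Omega> :: "'a::euclidean_space set"
  defines "V \<equiv> unit_ball_vol (real DIM('a))"
  assumes s: "0 < s" "s < 1" and \<Omega>: "open \<Omega>" "bounded \<Omega>" and sol: "weak_solution s \<Omega> f u"
    and f: "f \<in> L_space (real DIM('a) / s) \<Omega>" and \<sigma>: "\<bar>\<sigma>\<bar> = 1" and t: "0 < t"
    and null: "AE x in lebesgue. x \<in> \<Omega> \<longrightarrow> \<sigma> * u x \<noteq> t"
    and E: "E = {x \<in> \<Omega>. t < \<sigma> * u x}" and pos: "0 < measure lebesgue E"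
  shows "V\<^sup>2 / 16 * (V / 8) powr (real DIM('a) / s - 1)
    \<le> (LINT x|lebesgue. indicator E x * \<bar>f x\<bar> powr (real DIM('a) / s))"
proof -
  define n where "n = DIM('a)"
  define p where "p = real n / s"
  define A where "A = measure lebesgue E"
  define J where "J = (LINT x|lebesgue. indicator E x * \<bar>f x\<bar> powr p)"
  define r where "r = (2 * A / V) powr (1 / real n)"
  define R where "R = r powr s"
  \<comment> \<open>With this value the term \<open>2 * \<epsilon>\<close> absorbs half of the left-hand side \<open>V / 2\<close> of the final estimate.\<close>
  define \<epsilon> where "\<epsilon> = V / 8"
  define M where "M = \<epsilon> powr (1 - p)"
  have n: "real n \<ge> 1" unfolding n_def using DIM_positive[where 'a='a] by linarith
  have p: "1 \<le> p" "s * p = real n" using s n by (auto simp: p_def field_simps)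
  have V: "V > 0" unfolding V_def by simp
  have A: "A > 0" using pos by (simp add: A_def)
  have r: "r > 0" using A V by (simp add: r_def)
  have R: "R > 0" using r by (simp add: R_def)
  have \<epsilon>: "\<epsilon> > 0" using V by (simp add: \<epsilon>_def)
  have rn: "r ^ n = 2 * A / V"
    using A V n by (simp add: r_def powr_powr flip: powr_realpow)
  have \<Omega>_meas [measurable]: "\<Omega> \<in> sets lebesgue" using \<Omega> by simp
  have fin: "emeasure lebesgue \<Omega> < \<infinity>" using \<Omega> emeasure_bounded_finite[of \<Omega>] by simp
  have [measurable]: "u \<in> borel_measurable lebesgue" using sol unfolding weak_solution_def Ws1_0_def by auto
  have E_meas [measurable]: "E \<in> sets lebesgue"
  proof -
    have "{x \<in> space lebesgue. t < \<sigma> * u x} \<in> sets lebesgue" by measurable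
    then have "\<Omega> \<inter> {x \<in> space lebesgue. t < \<sigma> * u x} \<in> sets lebesgue" by (intro sets.Int) auto
    moreover have "\<Omega> \<inter> {x \<in> space lebesgue. t < \<sigma> * u x} = E" by (auto simp: E)
    ultimately show ?thesis by (simp only:)
  qed
  have E_fin: "emeasure lebesgue E < \<infinity>"
    using fin emeasure_mono[of E \<Omega> lebesgue] E by (auto intro: le_less_trans)
  have f_int: "set_integrable lebesgue \<Omega> f"
    using L_space_integrable[OF \<Omega>_meas fin p(1)] f by (simp add: p_def n_def)
  have sub: "E \<subseteq> \<Omega>" by (auto simp: E)
  have fE: "integrable lebesgue (\<lambda>x. indicator E x * (\<sigma> * f x))"
  proof -
    have "integrable lebesgue (\<lambda>x. \<sigma> * (indicator E x * f x))"
      using set_integrable_subset[OF f_int E_meas sub] by (simp add: set_integrable_def)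
    then show ?thesis by (simp add: mult.left_commute)
  qed
  have fpE: "integrable lebesgue (\<lambda>x. indicator E x * \<bar>f x\<bar> powr p)"
    using set_integrable_subset[of lebesgue \<Omega> "\<lambda>x. \<bar>f x\<bar> powr p" E] f sub
    by (simp add: set_integrable_def L_space_def p_def n_def)
  have 1: "integrable lebesgue (\<lambda>x. indicator E x :: real)" using E_fin by (intro integrable_real_indicator) auto
  define I where "I = (LINT x|lebesgue. indicator E x * (\<sigma> * f x))"
  have "ennreal (A\<^sup>2 * r powr (- (real n + s))) \<le> ennreal (2 * I)"
  proof -
    have "ennreal (A\<^sup>2 * r powr (- (real n + s))) \<le> (\<integral>\<^sup>+p. ennreal (gagliardo s (indicator E) p) \<partial>lebesgue)"
    proof -
      have "V * r ^ n = 2 * A" using V by (simp add: rn)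
      then show ?thesis unfolding A_def n_def V_def by (rule gagliardo_indicator_ge[OF E_meas E_fin r s(1)])
    qed
    also have "\<dots> \<le> ennreal (2 * I)"
      using superlevel_set_energy_le[OF s \<Omega> sol f_int \<sigma> t null] unfolding I_def E .
    finally show ?thesis .
  qed
  moreover have "0 < A\<^sup>2 * r powr (- (real n + s))" using A r by simp
  ultimately have low: "A\<^sup>2 * r powr (- (real n + s)) \<le> 2 * I" by (auto simp: ennreal_le_iff2)
  \<comment> \<open>The splitting threshold \<open>\<epsilon> / R\<close> scales in \<open>r\<close> like the isoperimetric lower bound divided by the
      measure of \<open>E\<close>.\<close>
  have "I \<le> (LINT x|lebesgue. \<epsilon> / R * indicator E x + (\<epsilon> / R) powr (1 - p) * (indicator E x * \<bar>f x\<bar> powr p))"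
    unfolding I_def
  proof (rule integral_mono[OF fE])
    show "integrable lebesgue (\<lambda>x. \<epsilon> / R * indicator E x + (\<epsilon> / R) powr (1 - p) * (indicator E x * \<bar>f x\<bar> powr p))"
      by (intro Bochner_Integration.integrable_add integrable_mult_right 1 fpE)
    fix x
    have "\<sigma> * f x \<le> \<bar>\<sigma> * f x\<bar>" by simp
    also have "\<dots> = \<bar>f x\<bar>" using \<sigma> by (simp add: abs_mult)
    also have "\<dots> \<le> \<epsilon> / R + (\<epsilon> / R) powr (1 - p) * \<bar>f x\<bar> powr p"
      using \<epsilon> R p by (intro abs_le_powr_split) auto
    finally show "indicator E x * (\<sigma> * f x) \<le> \<epsilon> / R * indicator E x + (\<epsilon> / R) powr (1 - p) * (indicator E x * \<bar>f x\<bar> powr p)"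
      by (auto split: split_indicator)
  qed
  also have "\<dots> = \<epsilon> / R * A + (\<epsilon> / R) powr (1 - p) * J"
    using 1 fpE by (simp add: A_def J_def)
  also have "(\<epsilon> / R) powr (1 - p) = M * (r ^ n / R)"
  proof -
    have "(\<epsilon> / R) powr (1 - p) = M * R powr (p - 1)"
      using powr_minus_divide[of R "1 - p"] by (simp add: M_def powr_divide)
    also have "R powr (p - 1) = r powr (real n - s)"
      unfolding R_def powr_powr by (simp add: right_diff_distrib p(2))
    also have "\<dots> = r ^ n / R" using r by (simp add: powr_diff R_def powr_realpow)
    finally show ?thesis .
  qed
  finally have up: "I \<le> \<epsilon> / R * A + M * (r ^ n / R) * J" .
  have r_eq: "r powr (- (real n + s)) = 1 / (r ^ n * R)"
    unfolding powr_minus_divide R_def powr_add using r by (simp add: powr_realpow)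
  have "A\<^sup>2 * r powr (- (real n + s)) \<le> 2 * (\<epsilon> / R * A + M * (r ^ n / R) * J)"
    by (rule order_trans[OF low mult_left_mono[OF up]]) simp
  then have "R * (A\<^sup>2 * (1 / (r ^ n * R))) \<le> R * (2 * (\<epsilon> / R * A + M * (r ^ n / R) * J))"
    unfolding r_eq using R by (intro mult_left_mono) simp_all
  moreover have "R * (A\<^sup>2 * (1 / (r ^ n * R))) = A\<^sup>2 / (2 * A / V)" unfolding rn using R by simp
  moreover have "A\<^sup>2 / (2 * A / V) = A * (V / 2)" using A by (simp add: power2_eq_square)
  moreover have "R * (2 * (\<epsilon> / R * A + M * (r ^ n / R) * J)) = 2 * \<epsilon> * A + 2 * M * (2 * A / V) * J"
    unfolding rn using R by (simp add: distrib_left)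
  moreover have "2 * \<epsilon> * A + 2 * M * (2 * A / V) * J = A * (2 * \<epsilon> + 4 * M * J / V)" by (simp add: distrib_left)
  ultimately have "A * (V / 2) \<le> A * (2 * \<epsilon> + 4 * M * J / V)" by (simp only:)
  then have "V / 2 \<le> 2 * \<epsilon> + 4 * M * J / V" using A by simp
  then have "V / 4 \<le> (4 * M * J) / V" unfolding \<epsilon>_def by linarith
  then have "V / 4 * V \<le> 4 * M * J" using V by (simp only: pos_le_divide_eq)
  then have "V\<^sup>2 / 16 \<le> M * J" by (simp add: power2_eq_square)
  then have "V\<^sup>2 / 16 * \<epsilon> powr (p - 1) \<le> (M * J) * \<epsilon> powr (p - 1)"
    by (rule mult_right_mono) simp
  also have "\<dots> = J * (\<epsilon> powr (1 - p) * \<epsilon> powr (p - 1))" by (simp add: M_def)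
  also have "\<epsilon> powr (1 - p) * \<epsilon> powr (p - 1) = 1" using \<epsilon> by (simp flip: powr_add)
  finally show ?thesis by (simp add: J_def \<epsilon>_def p_def n_def)
qed

text \<open>Null level sets make the integral over \<open>{x. t < h x}\<close> continuous in \<open>t\<close>. It tends to \<open>0\<close> as \<open>t\<close> grows, so
  the intermediate value theorem provides a level at which it is positive and as small as desired. Its
  value there differs from the one at \<open>0\<close>, whence \<open>t > 0\<close>.\<close>

lemma small_superlevel_integral:
  fixes g h :: "'a \<Rightarrow> real"
  assumes g: "integrable M g" "\<And>x. 0 \<le> g x" and [measurable]: "h \<in> borel_measurable M"
    and null: "\<And>t. 0 \<le> t \<Longrightarrow> AE x in M. g x \<noteq> 0 \<longrightarrow> h x \<noteq> t"
    and pos: "0 < (LINT x|M. indicator {x. 0 < h x} x * g x)" and \<delta>: "0 < \<delta>"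
  shows "\<exists>t>0. 0 < (LINT x|M. indicator {x. t < h x} x * g x) \<and> (LINT x|M. indicator {x. t < h x} x * g x) < \<delta>"
proof -
  define G where "G t = (LINT x|M. indicator {x. t < h x} x * g x)" for t :: real
  have [measurable]: "g \<in> borel_measurable M" using g(1) by (rule borel_measurable_integrable)
  have meas: "(\<lambda>x. indicator {x. t < h x} x * g x) \<in> borel_measurable M" for t :: real
  proof -
    have "(\<lambda>x. (if t < h x then 1 else 0) * g x) \<in> borel_measurable M" by measurable
    then show ?thesis by (simp add: indicator_def of_bool_def)
  qed
  have bound: "AE x in M. norm (indicator {x. t < h x} x * g x) \<le> g x" for t :: real
    using g(2) by (auto split: split_indicator)
  have cont: "continuous_on {0..} G"
    unfolding continuous_on_sequentially
  proof (intro allI ballI impI)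
    fix a :: "nat \<Rightarrow> real" and b :: real
    assume "b \<in> {0..}" and ab: "(\<forall>n. a n \<in> {0..}) \<and> a \<longlonglongrightarrow> b"
    then have "AE x in M. g x \<noteq> 0 \<longrightarrow> h x \<noteq> b" using null by simp
    then have "AE x in M. (\<lambda>k. indicator {x. a k < h x} x * g x) \<longlonglongrightarrow> indicator {x. b < h x} x * g x"
    proof eventually_elim
      case (elim x)
      show ?case
      proof (cases "g x = 0")
        case False
        then consider "h x < b" | "b < h x" using elim by linarith
        then have "\<forall>\<^sub>F k in sequentially. indicator {x. a k < h x} x * g x = indicator {x. b < h x} x * g x"
        proof cases
          case 1
          then have "\<forall>\<^sub>F k in sequentially. h x < a k" using ab by (intro order_tendstoD(1)[of _ b]) auto
          then show ?thesis by eventually_elim (use 1 in auto)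
        next
          case 2
          then have "\<forall>\<^sub>F k in sequentially. a k < h x" using ab by (intro order_tendstoD(2)[of _ b]) auto
          then show ?thesis by eventually_elim (use 2 in auto)
        qed
        then show ?thesis by (rule tendsto_eventually)
      qed simp
    qed
    then show "(G \<circ> a) \<longlonglongrightarrow> G b"
      unfolding G_def o_def by (intro integral_dominated_convergence[where w=g] meas g(1) bound)
  qed
  have "(\<lambda>k. G (real k)) \<longlonglongrightarrow> (LINT x|M. 0)"
    unfolding G_def
  proof (intro integral_dominated_convergence[where w=g] meas g(1) bound)
    show "AE x in M. (\<lambda>k. indicator {x. real k < h x} x * g x) \<longlonglongrightarrow> 0"
    proof (rule AE_I2)
      fix x
      have "\<forall>\<^sub>F k in sequentially. h x \<le> real k"
        using filterlim_real_sequentially unfolding filterlim_at_top by blast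
      then have "\<forall>\<^sub>F k in sequentially. indicator {x. real k < h x} x * g x = 0" by eventually_elim auto
      then show "(\<lambda>k. indicator {x. real k < h x} x * g x) \<longlonglongrightarrow> 0" by (rule tendsto_eventually)
    qed
  qed auto
  then have lim: "(\<lambda>k. G (real k)) \<longlonglongrightarrow> 0" by simp
  define c where "c = min (G 0) \<delta> / 2"
  have c: "0 < c" "c < G 0" "c < \<delta>" using pos \<delta> by (auto simp: c_def G_def min_def)
  obtain N where N: "G (real N) < c"
    using order_tendstoD(2)[OF lim c(1)] unfolding eventually_sequentially by blast
  obtain t where t: "0 \<le> t" "G t = c"
    using IVT2'[of G "real N" c 0] N c continuous_on_subset[OF cont, of "{0..real N}"] by auto
  then have "t \<noteq> 0" using c by auto
  then show ?thesis using t c unfolding G_def by (intro exI[of _ t]) auto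
qed

text \<open>If all level sets are null, then so is \<open>{x \<in> \<Omega>. u x = 0}\<close>, hence \<open>u\<close> or \<open>-u\<close> is positive on a set of
  positive measure. The summand \<open>1\<close> in the weight \<open>g\<close> lets the integral of \<open>g\<close> over a superlevel set
  detect whether that set has positive measure.\<close>

lemma weak_solution_has_fat_level_set:
  fixes \<Omega> :: "'a::euclidean_space set"
  assumes s: "0 < s" "s < 1" and \<Omega>: "open \<Omega>" "bounded \<Omega>" "\<Omega> \<noteq> {}"
    and f: "f \<in> L_space (real DIM('a) / s) \<Omega>" and sol: "weak_solution s \<Omega> f u"
  shows "\<exists>c. {x \<in> \<Omega>. u x = c} \<in> sets lebesgue \<and> 0 < emeasure lebesgue {x \<in> \<Omega>. u x = c}"
proof (rule ccontr)
  assume contra: "\<not> ?thesis"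
  define p where "p = real DIM('a) / s"
  have \<Omega>_meas [measurable]: "\<Omega> \<in> sets lebesgue" using \<Omega> by simp
  have fin: "emeasure lebesgue \<Omega> < \<infinity>" using \<Omega> emeasure_bounded_finite[of \<Omega>] by simp
  have [measurable]: "u \<in> borel_measurable lebesgue" using sol unfolding weak_solution_def Ws1_0_def by auto
  have level_meas: "{x \<in> \<Omega>. P (u x)} \<in> sets lebesgue" if [measurable]: "Measurable.pred borel P" for P
  proof -
    have "{x \<in> space lebesgue. P (u x)} \<in> sets lebesgue" by measurable
    then have "\<Omega> \<inter> {x \<in> space lebesgue. P (u x)} \<in> sets lebesgue" by (intro sets.Int) auto
    moreover have "\<Omega> \<inter> {x \<in> space lebesgue. P (u x)} = {x \<in> \<Omega>. P (u x)}" by auto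
    ultimately show ?thesis by (simp only:)
  qed
  have null: "AE x in lebesgue. x \<in> \<Omega> \<longrightarrow> u x \<noteq> c" for c
  proof -
    have m: "{x \<in> \<Omega>. u x = c} \<in> sets lebesgue" by (rule level_meas) measurable
    then have "{x \<in> \<Omega>. u x = c} \<in> null_sets lebesgue"
      using contra by (intro null_setsI) (auto simp: not_less zero_less_iff_neq_zero)
    then show ?thesis using AE_not_in by force
  qed
  have "\<exists>\<sigma>. \<bar>\<sigma>\<bar> = 1 \<and> \<not> (AE x in lebesgue. x \<in> \<Omega> \<longrightarrow> \<not> 0 < \<sigma> * u x)"
  proof (rule ccontr)
    assume "\<not> ?thesis"
    then have "AE x in lebesgue. x \<in> \<Omega> \<longrightarrow> \<not> 0 < 1 * u x" "AE x in lebesgue. x \<in> \<Omega> \<longrightarrow> \<not> 0 < (-1) * u x"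
      by (metis abs_one, metis abs_minus_cancel abs_one)
    with null[of 0] have "AE x in lebesgue. x \<notin> \<Omega>" by eventually_elim auto
    then have "\<Omega> \<in> null_sets lebesgue" by (simp add: AE_iff_null_sets[OF \<Omega>_meas])
    then have "negligible \<Omega>" by (simp add: negligible_iff_null_sets)
    then show False using \<Omega> open_not_negligible by blast
  qed
  then obtain \<sigma> :: real where \<sigma>: "\<bar>\<sigma>\<bar> = 1" and fat: "\<not> (AE x in lebesgue. x \<in> \<Omega> \<longrightarrow> \<not> 0 < \<sigma> * u x)" by blast
  have \<sigma>2: "\<sigma> * \<sigma> = 1" using \<sigma> by (auto simp: abs_if split: if_splits)
  have null_\<sigma>: "AE x in lebesgue. x \<in> \<Omega> \<longrightarrow> \<sigma> * u x \<noteq> t" for t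
    using null[of "\<sigma> * t"]
  proof eventually_elim
    case (elim x)
    then show ?case using \<sigma>2 by (metis mult.assoc mult_1)
  qed
  define g where "g x = indicator \<Omega> x * (1 + \<bar>f x\<bar> powr p)" for x
  have g0: "0 \<le> g x" for x by (simp add: g_def)
  have fp: "integrable lebesgue (\<lambda>x. indicator \<Omega> x * \<bar>f x\<bar> powr p)"
    using f by (simp add: L_space_def set_integrable_def p_def)
  have g: "integrable lebesgue g"
    unfolding g_def distrib_left using fp fin
    by (intro Bochner_Integration.integrable_add) (auto intro: integrable_real_indicator)
  have [measurable]: "g \<in> borel_measurable lebesgue" using g by (rule borel_measurable_integrable)
  define E where "E t = {x \<in> \<Omega>. t < \<sigma> * u x}" for t
  have E_meas [measurable]: "E t \<in> sets lebesgue" for t unfolding E_def by (rule level_meas) measurable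
  have G_E: "indicator {x. t < \<sigma> * u x} x * g x = indicator (E t) x * g x" for t x
    by (auto simp: E_def g_def split: split_indicator)
  have g_E: "integrable lebesgue (\<lambda>x. indicator (E t) x * g x)" for t
    using integrable_real_mult_indicator[OF E_meas g] by (simp add: mult.commute)
  have zero_iff: "(LINT x|lebesgue. indicator (E t) x * g x) = 0 \<longleftrightarrow> (AE x in lebesgue. x \<notin> E t)" for t
  proof -
    have "(indicator (E t) x * g x = 0) \<longleftrightarrow> x \<notin> E t" for x
    proof -
      have "x \<in> \<Omega> \<Longrightarrow> g x > 0" by (simp add: g_def add_pos_nonneg)
      then show ?thesis by (auto simp: E_def split: split_indicator)
    qed
    moreover have "(LINT x|lebesgue. indicator (E t) x * g x) = 0 \<longleftrightarrow> (AE x in lebesgue. indicator (E t) x * g x = 0)"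
      by (rule integral_nonneg_eq_0_iff_AE[OF g_E]) (simp add: g0)
    ultimately show ?thesis by (simp only:)
  qed
  have nonneg: "0 \<le> (LINT x|lebesgue. indicator (E t) x * g x)" for t
    by (intro integral_nonneg_AE) (simp add: g0)
  let ?V = "unit_ball_vol (real DIM('a))"
  let ?\<delta> = "?V\<^sup>2 / 16 * (?V / 8) powr (real DIM('a) / s - 1)"
  have "\<exists>t>0. 0 < (LINT x|lebesgue. indicator {x. t < \<sigma> * u x} x * g x) \<and> (LINT x|lebesgue. indicator {x. t < \<sigma> * u x} x * g x) < ?\<delta>"
  proof (rule small_superlevel_integral[OF g g0])
    show "AE x in lebesgue. g x \<noteq> 0 \<longrightarrow> \<sigma> * u x \<noteq> t" for t
      using null_\<sigma>[of t] by eventually_elim (auto simp: g_def)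
    have "(LINT x|lebesgue. indicator (E 0) x * g x) \<noteq> 0"
      using fat unfolding zero_iff by (simp add: E_def)
    then show "0 < (LINT x|lebesgue. indicator {x. 0 < \<sigma> * u x} x * g x)"
      unfolding G_E using nonneg[of 0] by linarith
    have "?V \<noteq> 0" using unit_ball_vol_pos[of "real DIM('a)"] by linarith
    then show "0 < ?\<delta>" by (intro mult_pos_pos divide_pos_pos) (simp_all add: powr_gt_zero)
  qed measurable
  then obtain t where t: "t > 0" and t_pos: "0 < (LINT x|lebesgue. indicator (E t) x * g x)"
    and t_small: "(LINT x|lebesgue. indicator (E t) x * g x) < ?\<delta>"
    unfolding G_E by blast
  have "emeasure lebesgue (E t) \<noteq> 0"
    using t_pos zero_iff[of t] AE_iff_null_sets[OF E_meas[of t]] by auto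
  moreover have "emeasure lebesgue (E t) < \<infinity>"
    using fin emeasure_mono[of "E t" \<Omega> lebesgue] by (auto simp: E_def intro: le_less_trans)
  ultimately have "0 < measure lebesgue (E t)"
    by (simp add: measure_def enn2real_positive_iff zero_less_iff_neq_zero)
  from superlevel_set_mass[OF s \<Omega>(1,2) sol f \<sigma> t null_\<sigma> E_def this]
  have "?\<delta> \<le> (LINT x|lebesgue. indicator (E t) x * \<bar>f x\<bar> powr p)" by (simp add: p_def)
  also have "\<dots> \<le> (LINT x|lebesgue. indicator (E t) x * g x)"
  proof (rule integral_mono[OF _ g_E])
    show "integrable lebesgue (\<lambda>x. indicator (E t) x * \<bar>f x\<bar> powr p)"
    proof -
      have "integrable lebesgue (\<lambda>x. (indicator \<Omega> x * \<bar>f x\<bar> powr p) * indicator (E t) x)"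
        by (rule integrable_real_mult_indicator[OF E_meas fp])
      moreover have "(indicator \<Omega> x * \<bar>f x\<bar> powr p) * indicator (E t) x = indicator (E t) x * \<bar>f x\<bar> powr p" for x
        by (auto simp: E_def split: split_indicator)
      ultimately show ?thesis by simp
    qed
    show "indicator (E t) x * \<bar>f x\<bar> powr p \<le> indicator (E t) x * g x" for x
      by (auto simp: E_def g_def split: split_indicator)
  qed
  finally show False using t_small by simp
qed

lemma emeasure_lebesgue_square_pos:
  fixes A :: "'a::euclidean_space set"
  assumes A: "A \<in> sets lebesgue" and pos: "0 < emeasure lebesgue A"
  shows "0 < emeasure lebesgue (A \<times> A)"
proof -
  let ?S = "main_part lborel A"
  have S: "?S \<in> sets lborel" "?S \<subseteq> A"
    using main_part_sets[OF A] main_part_null_part_Un[OF A] by blast+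
  have "0 < emeasure lborel ?S" using pos emeasure_completion[OF A] by simp
  then have "0 < emeasure lborel ?S * emeasure lborel ?S" by (simp add: ennreal_zero_less_mult_iff)
  also have "\<dots> = emeasure (lborel \<Otimes>\<^sub>M lborel) (?S \<times> ?S)" using S(1) by (simp add: lborel.emeasure_pair_measure_Times)
  also have "\<dots> = emeasure lborel (?S \<times> ?S)" by (simp add: lborel_prod)
  also have "\<dots> = emeasure lebesgue (?S \<times> ?S)"
  proof -
    have "?S \<times> ?S \<in> sets (lborel \<Otimes>\<^sub>M lborel)" using S(1) by (intro pair_measureI)
    then have "?S \<times> ?S \<in> sets lborel" by (simp only: lborel_prod)
    then show ?thesis by simp
  qed
  also have "\<dots> \<le> emeasure lebesgue (A \<times> A)"
    using S(2) A by (intro emeasure_mono sets_lebesgue_Times) auto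
  finally show ?thesis .
qed

lemma AE_lebesgue_off_diagonal: "AE p in (lebesgue :: ('a::euclidean_space \<times> 'a) measure). fst p \<noteq> snd p"
proof -
  obtain b :: 'a where b: "b \<in> Basis" using nonempty_Basis by blast
  have "negligible {p :: 'a \<times> 'a. (b, - b) \<bullet> p = 0}"
    using b nonzero_Basis by (intro negligible_hyperplane) (auto simp: zero_prod_def)
  then have "AE p in (lebesgue :: ('a \<times> 'a) measure). p \<notin> {p. (b, - b) \<bullet> p = 0}"
    by (simp only: negligible_iff_null_sets AE_not_in)
  then show ?thesis by eventually_elim (auto simp: inner_prod_def)
qed

theorem theorem6p1:
  fixes \<Omega> :: "'a::euclidean_space set" and f :: "'a \<Rightarrow> real" and s :: real
  assumes "0 < s" and "s < 1"
    and "open \<Omega>" and "bounded \<Omega>" and "\<Omega> \<noteq> {}" and "lipschitz_boundary \<Omega>"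
    and "f \<in> L_space (real DIM('a) / s) \<Omega>"
  shows "(\<forall>u\<in>Ws1_0 s \<Omega>. weak_solution s \<Omega> f u \<longrightarrow>
            {(x, y) \<in> Q \<Omega>. u x = u y} \<in> sets lebesgue \<and>
            emeasure lebesgue {(x, y) \<in> Q \<Omega>. u x = u y} > 0) \<and>
         \<not> (\<exists>u\<in>Ws1_0 s \<Omega>.
              (AE (x, y) in lebesgue. (x, y) \<in> Q \<Omega> \<and> x \<noteq> y \<longrightarrow> u x \<noteq> u y) \<and>
              weak_solution s \<Omega> f u)"
proof -
  have main: "{(x, y) \<in> Q \<Omega>. u x = u y} \<in> sets lebesgue \<and>
      emeasure lebesgue {(x, y) \<in> Q \<Omega>. u x = u y} > 0" if sol: "weak_solution s \<Omega> f u" for u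
  proof -
    have u: "u \<in> borel_measurable lebesgue" using sol unfolding weak_solution_def Ws1_0_def by auto
    have \<Omega>: "UNIV - \<Omega> \<in> sets lebesgue" using assms(3) by (intro sets.Diff) auto
    note [measurable] = measurable_compose[OF measurable_lebesgue_fst_snd(1) u]
      measurable_compose[OF measurable_lebesgue_fst_snd(2) u]
    have "{p \<in> space (lebesgue :: ('a \<times> 'a) measure). u (fst p) = u (snd p)} \<in> sets lebesgue" by measurable
    moreover have "UNIV - (UNIV - \<Omega>) \<times> (UNIV - \<Omega>) \<in> sets (lebesgue :: ('a \<times> 'a) measure)"
      using sets_lebesgue_Times[OF \<Omega> \<Omega>] by (intro sets.Diff) auto
    moreover have "{(x, y) \<in> Q \<Omega>. u x = u y} = (UNIV - (UNIV - \<Omega>) \<times> (UNIV - \<Omega>)) \<inter>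
        {p \<in> space (lebesgue :: ('a \<times> 'a) measure). u (fst p) = u (snd p)}"
      by (auto simp: Q_def)
    ultimately have meas: "{(x, y) \<in> Q \<Omega>. u x = u y} \<in> sets lebesgue" by (simp only: sets.Int)
    obtain c where "{x \<in> \<Omega>. u x = c} \<in> sets lebesgue" "0 < emeasure lebesgue {x \<in> \<Omega>. u x = c}"
      using weak_solution_has_fat_level_set[OF assms(1-5) assms(7) sol] by blast
    then have "0 < emeasure lebesgue ({x \<in> \<Omega>. u x = c} \<times> {x \<in> \<Omega>. u x = c})"
      by (rule emeasure_lebesgue_square_pos)
    also have "\<dots> \<le> emeasure lebesgue {(x, y) \<in> Q \<Omega>. u x = u y}"
      by (rule emeasure_mono[OF _ meas]) (auto simp: Q_def)
    finally show ?thesis using meas by blast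
  qed
  moreover have False if "AE (x, y) in lebesgue. (x, y) \<in> Q \<Omega> \<and> x \<noteq> y \<longrightarrow> u x \<noteq> u y"
    and sol: "weak_solution s \<Omega> f u" for u
  proof -
    have "AE p in lebesgue. p \<notin> {(x, y) \<in> Q \<Omega>. u x = u y}"
      using that(1) AE_lebesgue_off_diagonal by eventually_elim auto
    then have "{(x, y) \<in> Q \<Omega>. u x = u y} \<in> null_sets lebesgue"
      using main[OF sol] by (simp add: AE_iff_null_sets)
    from null_setsD1[OF this] show False using conjunct2[OF main[OF sol]] by (simp only: less_irrefl)
  qed
  ultimately show ?thesis by blast
qed

end
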